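(* Let $\tilde S\subseteq S$ be nonempty with $\mathcal L_t(x,y)=0$ for all $t\ge0$ and all $(x,y)\in\tilde S\times\tilde S^c$. For $t\ge0$ let $\tilde\mu_t(x)=\mu_t(\{x\}\cap\tilde S)/\mu_t(\tilde S)$ be the conditional measure, $\tilde H_t=H_t-\int H_t\,d\tilde\mu_t$, and $\tilde{\mathcal E}_t(f)=-\int f\,\mathcal L_tf\,d\tilde\mu_t$. Assume that for every $t\ge0$ there are real constants $\tilde A_t,\tilde B_t,\tilde C_t$ such that for all $f:S\to\mathbb R$ $$\mathrm{Var}_{\tilde\mu_t}(f)\le\tilde C_t\,\tilde{\mathcal E}_t(f),\qquad -\int\tilde H_t\Big(f-\int f\,d\tilde\mu_t\Big)^2d\tilde\mu_t\le\tilde A_t\,\tilde{\mathcal E}_t(f),\qquad \Big|\int\tilde H_tf\,d\tilde\mu_t\Big|^2\le\tilde B_t\,\tilde{\mathcal E}_t(f).$$ Then the following hold for all $t,\alpha,\beta\ge0$. (i) Let $p\in[2,\infty)$. If $\lambda_s\ge\frac p4\tilde A_s+\frac{p(p+3)}4\,t\,\tilde B_s$ for all $s\in[0,t]$, then $$\|q_{s,t}f\|_{L^p(\tilde\mu_s)}\le 2^{1/4}\,\frac{\mu_t(\tilde S)}{\mu_s(\tilde S)}\,\|f\|_{L^p(\tilde\mu_t)}$$ for all $f:S\to\mathbb R$ and $s\in[0,t]$. (ii) If $\lambda_s\ge\frac12\tilde A_s+\alpha\tilde C_s$ for all $s\in[0,t]$, then $$\|q_{s,t}f\|_{L^2(\tilde\mu_s)}\le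 e^{-\alpha(t-s)}\,\frac{\mu_t(\tilde S)}{\mu_s(\tilde S)}\,\|f\|_{L^2(\tilde\mu_t)}$$ for all $s\in[0,t]$ and all $f:S\to\mathbb R$ with $\int f\,d\tilde\mu_t=0$. (iii) If $p=2^n$ for some integer $n\ge1$ and $\lambda_s\ge\frac p4\tilde A_s+\beta\frac{p-1}4\tilde B_s+\alpha\frac p2\tilde C_s$ for all $s\in[0,t]$, then $$\|q_{s,t}f\|_{L^p(\tilde\mu_s)}\le e^{-\alpha(t-s)}\Big(2+\frac1{\alpha\beta}\Big)^{1/2}\frac{\mu_t(\tilde S)}{\mu_s(\tilde S)}\,\|f\|_{L^p(\tilde\mu_t)}$$ for all $s\in[0,t]$ and all $f:S\to\mathbb R$ with $\int f\,d\tilde\mu_t=0$, where $1/(\alpha\beta):=+\infty$ if $\alpha\beta=0$ (and $\infty\cdot0=0$).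
   Context: **Setting.** $S$ is a finite set. For $t\ge0$, $\mu_t(x)=\frac1{Z_t}e^{-\mathcal H_t(x)}\mu_0(x)$ are probability measures on $S$ with $\mu_t(x)>0$ for all $x\in S$, where $Z_t$ is a normalization constant and $(t,x)\mapsto\mathcal H_t(x)$ is a function on $[0,\infty)\times S$ that is continuously differentiable in $t$. Put $$H_t(x):=-\frac{\partial}{\partial t}\log\mu_t(x)=\frac{\partial}{\partial t}\mathcal H_t(x)-\int\frac{\partial}{\partial t}\mathcal H_t\,d\mu_t .$$ For each $t\ge0$, $\mathcal L_t=(\mathcal L_t(x,y))_{x,y\in S}$ is a $Q$-matrix (off-diagonal entries $\ge0$, row sums $0$), continuous in $t$, satisfying detailed balance $\mu_t(x)\mathcal L_t(x,y)=\mu_t(y)\mathcal L_t(y,x)$ for all $x,y\in S$; $(\mathcal L_tf)(x)=\sum_y\mathcal L_t(x,y)f(y)$. A continuous function $t\mapsto\lambda_t\in(0,\infty)$ is fixed. For $0\le s\le t$ and $f:S\to\mathbb R$, $q_{s,t}f:S\to\mathbb R$ is the unique solution of the backward equation $$-\frac{\partial}{\partial s}q_{s,t}f=\lambda_s\mathcal L_sq_{s,t}f-H_s\,q_{s,t}f,\quad s\in[0,t],\qquad q_{t,t}f=f.$$ **Norms.** $\|f\|_{L^p(\mu)}=\big(\sum_x|f(x)|^p\mu(x)\big)^{1/p}$. *)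

theory Defs
  imports "HOL-Probability.Probability"
begin

text \<open>
  The finite state space is the type \<^typ>\<open>'a\<close>. Time parameters are real numbers of which only
  the values in \<open>[0,\<infinity>)\<close> matter; derivatives in time are taken within the interval in question,
  i.e. they are one-sided at its end points.
\<close>

definition generator :: "('a::finite \<Rightarrow> 'a \<Rightarrow> real) \<Rightarrow> ('a \<Rightarrow> real) \<Rightarrow> 'a \<Rightarrow> real" where
  "generator Q f x = (\<Sum>y\<in>UNIV. Q x y * f y)"

definition Q_matrix :: "('a::finite \<Rightarrow> 'a \<Rightarrow> real) \<Rightarrow> bool" where
  "Q_matrix Q \<longleftrightarrow> (\<forall>x y. x \<noteq> y \<longrightarrow> Q x y \<ge> 0) \<and> (\<forall>x. (\<Sum>y\<in>UNIV. Q x y) = 0)"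

definition Lp_norm :: "real \<Rightarrow> ('a::finite) pmf \<Rightarrow> ('a \<Rightarrow> real) \<Rightarrow> real" where
  "Lp_norm p \<mu> f = (\<Sum>x\<in>UNIV. \<bar>f x\<bar> powr p * pmf \<mu> x) powr (1 / p)"

text \<open>
  \<open>U t x\<close> is the energy \<open>\<H>\<^sub>t(x)\<close> and \<open>Z t\<close> the normalization constant, whose value is
  determined by the first assumption because each \<open>\<mu> t\<close> has total mass one.
\<close>

locale feynman_kac_setting =
  fixes \<mu> :: "real \<Rightarrow> ('a::finite) pmf"
    and Z :: "real \<Rightarrow> real"
    and U :: "real \<Rightarrow> 'a \<Rightarrow> real"
    and L :: "real \<Rightarrow> 'a \<Rightarrow> 'a \<Rightarrow> real"
    and lam :: "real \<Rightarrow> real"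
  assumes gibbs: "t \<ge> 0 \<Longrightarrow> pmf (\<mu> t) x = 1 / Z t * exp (- U t x) * pmf (\<mu> 0) x"
    and pos: "t \<ge> 0 \<Longrightarrow> pmf (\<mu> t) x > 0"
    and U_differentiable: "(\<lambda>t. U t x) differentiable_on {0..}"
    and U_deriv_continuous:
      "continuous_on {0..} (\<lambda>t. vector_derivative (\<lambda>s. U s x) (at t within {0..}))"
    and L_Q_matrix: "t \<ge> 0 \<Longrightarrow> Q_matrix (L t)"
    and L_continuous: "continuous_on {0..} (\<lambda>t. L t x y)"
    and detailed_balance:
      "t \<ge> 0 \<Longrightarrow> pmf (\<mu> t) x * L t x y = pmf (\<mu> t) y * L t y x"
    and lam_continuous: "continuous_on {0..} lam"
    and lam_pos: "t \<ge> 0 \<Longrightarrow> lam t > 0"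

definition H :: "(real \<Rightarrow> ('a::finite) pmf) \<Rightarrow> real \<Rightarrow> 'a \<Rightarrow> real" where
  "H \<mu> t x = - vector_derivative (\<lambda>s. ln (pmf (\<mu> s) x)) (at t within {0..})"

text \<open>
  \<open>u\<close> solves \<open>- \<partial>u\<^sub>s/\<partial>s = lam s * generator (L s) u\<^sub>s - H\<^sub>s u\<^sub>s\<close> on \<open>[0,t]\<close> with terminal value \<open>f\<close>.
  This is a linear equation with continuous coefficients, so \<open>u\<close> is determined on \<open>[0,t]\<close>.
\<close>

definition solves_backward ::
  "(real \<Rightarrow> ('a::finite) pmf) \<Rightarrow> (real \<Rightarrow> 'a \<Rightarrow> 'a \<Rightarrow> real) \<Rightarrow> (real \<Rightarrow> real) \<Rightarrow>
    real \<Rightarrow> ('a \<Rightarrow> real) \<Rightarrow> (real \<Rightarrow> 'a \<Rightarrow> real) \<Rightarrow> bool" where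
  "solves_backward \<mu> L lam t f u \<longleftrightarrow>
     u t = f \<and>
     (\<forall>s\<in>{0..t}. \<forall>x. ((\<lambda>r. u r x) has_real_derivative
        - (lam s * generator (L s) (u s) x - H \<mu> s x * u s x)) (at s within {0..t}))"

definition cond_H :: "(real \<Rightarrow> ('a::finite) pmf) \<Rightarrow> 'a set \<Rightarrow> real \<Rightarrow> 'a \<Rightarrow> real" where
  "cond_H \<mu> T t x = H \<mu> t x - measure_pmf.expectation (cond_pmf (\<mu> t) T) (H \<mu> t)"

definition cond_form ::
  "(real \<Rightarrow> ('a::finite) pmf) \<Rightarrow> (real \<Rightarrow> 'a \<Rightarrow> 'a \<Rightarrow> real) \<Rightarrow> 'a set \<Rightarrow> real \<Rightarrow> ('a \<Rightarrow> real) \<Rightarrow> real"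
where
  "cond_form \<mu> L T t f =
     - measure_pmf.expectation (cond_pmf (\<mu> t) T) (\<lambda>x. f x * generator (L t) f x)"

text \<open>
  \<open>(2 + 1/(\<alpha>\<beta>))\<^sup>1\<^sup>/\<^sup>2\<close> for \<open>\<alpha>, \<beta> \<ge> 0\<close> with \<open>1/0 = \<infinity>\<close>, which is not the convention of
  real division. The product on \<^typ>\<open>ereal\<close> satisfies \<open>\<infinity> * 0 = 0\<close>.
\<close>

definition amplification :: "real \<Rightarrow> real \<Rightarrow> ereal" where
  "amplification \<alpha> \<beta> = (if \<alpha> * \<beta> = 0 then \<infinity> else ereal (sqrt (2 + 1 / (\<alpha> * \<beta>))))"

end

theory Submission
  imports Defs
begin

text \<open>
  On the invariant set, \<open>w\<^sub>s = q\<^sub>s\<^sub>,\<^sub>t f \<cdot> \<mu>\<^sub>s(T)/\<mu>\<^sub>t(T)\<close> solves the backward equation with the centred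
  potential, and the conditional measures satisfy \<open>\<partial>\<mu>\<^sub>s = - h \<mu>\<^sub>s\<close>. The Stroock-Varopoulos inequality and
  the three functional inequalities applied to \<open>g = |w|\<^bsup>p/2\<^esup>\<close> bound the time derivative of the \<open>p\<close>-th
  moment from below in terms of the moments of order \<open>p\<close> and \<open>p/2\<close>. The moment of order \<open>p/2\<close> is
  interpolated between the \<open>p\<close>-th moment and a lower one with a known bound: the first moment, which
  is contracted, in (i), and the second moment of a function of mean zero in (iii). This gives a scalar
  differential inequality which is solved by a barrier argument. Mean zero is preserved, so for
  \<open>p = 2\<close> the Poincare inequality yields (ii) directly.
\<close>

section \<open>Scalar inequalities and comparison\<close>

text \<open>The potential enters the density and the solution with opposite signs, so in the
  derivative of the mean of F(w) it multiplies F'(w) w - F(w): this vanishes for the mean and is p -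
  1 times the integrand for the moment of order p. What remains must be paid for by the Dirichlet
  form. Centring g at its mean a leaves a cross term 2 a b, with b the mean of h g, bounded below by
  - \<kappa> b^2 - a^2 / \<kappa>. The first part is charged to the third inequality; the second, a
  multiple of the squared moment of order p/2, keeps the estimate from closing at order p. The free
  weight \<kappa> is (p + 3) t for growth, so that the total loss over [0,t] does not depend on t,
  and \<beta> (p - 1) / p for decay, which produces the coefficient \<beta> (p - 1) / 4 in (iii).
  Data are prescribed at the final time, so lower bounds on derivatives give upper bounds at earlier
  times. Direct interpolation with the second moment asks for p/2 \<ge> 2 and treats all orders p
  \<ge> 4 at once.\<close>

definition signed_powr :: "real \<Rightarrow> real \<Rightarrow> real" where
  "signed_powr r x = sgn x * \<bar>x\<bar> powr r"

lemma signed_powr_minus [simp]: "signed_powr r (- x) = - signed_powr r x"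
  by (simp add: signed_powr_def sgn_minus)

text \<open>Turns the pairing of a function with the derivative of its power back into a moment. At
  \<open>x = 0\<close> both sides vanish for every \<open>r\<close>, because
  \<open>0 powr r = 0\<close> even for exponent zero.\<close>

lemma signed_powr_mult_self: "x * signed_powr r x = \<bar>x\<bar> powr (r + 1)"
proof -
  have "x * signed_powr r x = (x * sgn x) * \<bar>x\<bar> powr r"
    by (simp add: signed_powr_def)
  also have "\<dots> = \<bar>x\<bar> powr 1 * \<bar>x\<bar> powr r"
    by (cases x "0::real" rule: linorder_cases) auto
  finally show ?thesis by (simp only: add.commute[of r] powr_add)
qed

lemma signed_powr_mono: assumes "r \<ge> 0" "x \<le> y" shows "signed_powr r x \<le> signed_powr r y"
proof -
  consider "0 \<le> x" | "x < 0" "0 \<le> y" | "y < 0" by linarith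
  then show ?thesis
  proof cases
    case 1
    then show ?thesis using assms by (auto simp: signed_powr_def sgn_if powr_mono2)
  next
    case 2
    have "- ((- x) powr r) \<le> 0" "0 \<le> y powr r" by auto
    then show ?thesis using 2 by (auto simp: signed_powr_def sgn_if simp del: neg_le_0_iff_le intro: order_trans)
  next
    case 3
    then have "(- y) powr r \<le> (- x) powr r" using assms by (intro powr_mono2) auto
    then show ?thesis using 3 assms by (auto simp: signed_powr_def sgn_if)
  qed
qed

lemma has_real_derivative_abs_powr:
  assumes "p > 1"
  shows "((\<lambda>x. \<bar>x\<bar> powr p) has_real_derivative p * signed_powr (p - 1) x) (at x)"
proof -
  consider "x > 0" | "x < 0" | "x = 0" by linarith
  then show ?thesis
  proof cases
    case 1
    have "((\<lambda>x. x powr p) has_real_derivative p * signed_powr (p - 1) x) (at x)"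
      using 1 by (auto intro!: derivative_eq_intros simp: signed_powr_def)
    then show ?thesis
    proof (rule DERIV_cong_ev[OF refl _ refl, THEN iffD1, rotated])
      show "eventually (\<lambda>y. y powr p = \<bar>y\<bar> powr p) (nhds x)"
      using eventually_nhds_in_open[of "{0<..}" x] 1 by (auto elim!: eventually_mono)
    qed
  next
    case 2
    have "((\<lambda>x. (- x) powr p) has_real_derivative p * signed_powr (p - 1) x) (at x)"
      using 2 by (auto intro!: derivative_eq_intros simp: signed_powr_def)
    then show ?thesis
    proof (rule DERIV_cong_ev[OF refl _ refl, THEN iffD1, rotated])
      show "eventually (\<lambda>y. (- y) powr p = \<bar>y\<bar> powr p) (nhds x)"
      using eventually_nhds_in_open[of "{..<0}" x] 2 by (auto elim!: eventually_mono)
    qed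
  next
    \<comment> \<open>The difference quotient at 0 has absolute value
      \<open>\<bar>y\<bar> powr (p - 1)\<close>, which tends to 0 because
      \<open>p > 1\<close>.\<close>
    case 3
    have "((\<lambda>y. \<bar>y\<bar> powr (p - 1)) \<longlongrightarrow> \<bar>0::real\<bar> powr (p - 1)) (at 0)"
      using assms by (intro tendsto_powr2 tendsto_intros) auto
    then have "((\<lambda>y. \<bar>y\<bar> powr (p - 1)) \<longlongrightarrow> 0) (at (0::real))" by simp
    moreover have "eventually (\<lambda>y. \<bar>y\<bar> powr (p - 1) = norm (\<bar>y\<bar> powr p / y)) (at (0::real))"
      unfolding eventually_at_filter by (auto intro!: always_eventually simp: powr_diff)
    ultimately have "((\<lambda>y. norm (\<bar>y\<bar> powr p / y)) \<longlongrightarrow> 0) (at (0::real))"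
      by (rule Lim_transform_eventually)
    then have "((\<lambda>y. \<bar>y\<bar> powr p / y) \<longlongrightarrow> 0) (at (0::real))"
      by (rule tendsto_norm_zero_cancel)
    then show ?thesis using 3 assms
      by (simp add: has_field_derivative_iff signed_powr_def)
  qed
qed

text \<open>The integrated form of \<open>2k \<cdot> (p/2) x\<^bsup>p/2-1\<^esup> \<le> k\<^sup>2 + (p\<^sup>2/4) x\<^bsup>p-2\<^esup>\<close>; the choice of \<open>k\<close>
  as a difference quotient replaces the Cauchy-Schwarz inequality for integrals.\<close>

lemma powr_difference_bound:
  fixes a b p :: real
  assumes "p > 1" "0 < b" "b < a"
  shows "4 * (p - 1) / p\<^sup>2 * (a powr (p / 2) - b powr (p / 2))\<^sup>2
    \<le> (a - b) * (a powr (p - 1) - b powr (p - 1))"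
proof -
  define k where "k = (a powr (p / 2) - b powr (p / 2)) / (a - b)"
  define F where "F x = 2 * k * x powr (p / 2) - k\<^sup>2 * x - p\<^sup>2 / (4 * (p - 1)) * x powr (p - 1)" for x :: real
  have kd: "k * (a - b) = a powr (p / 2) - b powr (p / 2)"
    using assms by (simp add: k_def)
  have "F a \<le> F b"
  proof (rule DERIV_nonpos_imp_nonincreasing[where f = F])
    fix x assume x: "b \<le> x" "x \<le> a"
    then have x0: "x > 0" using assms by linarith
    have "(F has_real_derivative
        2 * k * (p / 2 * x powr (p / 2 - 1)) - k\<^sup>2 - p\<^sup>2 / (4 * (p - 1)) * ((p - 1) * x powr (p - 2))) (at x)"
      unfolding F_def using x0 assms
      by (auto intro!: derivative_eq_intros)
    moreover have "p\<^sup>2 / (4 * (p - 1)) * ((p - 1) * x powr (p - 2)) = (p / 2 * x powr (p / 2 - 1))\<^sup>2"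
    proof -
      have "x powr (p - 2) = (x powr (p / 2 - 1))\<^sup>2"
        using x0 by (simp add: power2_eq_square flip: powr_add)
      then show ?thesis using assms by (simp add: field_simps power2_eq_square)
    qed
    moreover have "2 * k * (p / 2 * x powr (p / 2 - 1)) - k\<^sup>2 - (p / 2 * x powr (p / 2 - 1))\<^sup>2 \<le> 0"
      using zero_le_power2[of "k - p / 2 * x powr (p / 2 - 1)"] by (simp add: power2_diff)
    ultimately show "\<exists>y. (F has_real_derivative y) (at x) \<and> y \<le> 0" by metis
  qed (use assms in auto)
  then have "2 * k * (k * (a - b)) - k\<^sup>2 * (a - b) \<le> p\<^sup>2 / (4 * (p - 1)) * (a powr (p - 1) - b powr (p - 1))"
    unfolding kd by (simp add: F_def algebra_simps diff_divide_distrib)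
  then have "k\<^sup>2 * (a - b) \<le> p\<^sup>2 / (4 * (p - 1)) * (a powr (p - 1) - b powr (p - 1))"
    by (simp add: power2_eq_square algebra_simps)
  then have "4 * (p - 1) / p\<^sup>2 * (a - b) * (k\<^sup>2 * (a - b))
      \<le> 4 * (p - 1) / p\<^sup>2 * (a - b) * (p\<^sup>2 / (4 * (p - 1)) * (a powr (p - 1) - b powr (p - 1)))"
    using assms by (intro mult_left_mono) auto
  also have "\<dots> = (a - b) * (a powr (p - 1) - b powr (p - 1))"
    using assms by (simp add: field_simps)
  also have "4 * (p - 1) / p\<^sup>2 * (a - b) * (k\<^sup>2 * (a - b)) = 4 * (p - 1) / p\<^sup>2 * (k * (a - b))\<^sup>2"
    by (simp add: power_mult_distrib power2_eq_square)
  finally show ?thesis unfolding kd .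
qed

text \<open>For equal signs this is \<open>powr_difference_bound\<close> up to symmetry and
  negation. For opposite signs the mixed products on the right have a favourable sign, and the
  coefficient on the left is at most 1 because (p - 2)^2 \<ge> 0. A zero value is counted with the
  opposite signs.\<close>

lemma stroock_varopoulos_scalar:
  fixes a b p :: real
  assumes "p > 1"
  shows "4 * (p - 1) / p\<^sup>2 * (\<bar>a\<bar> powr (p / 2) - \<bar>b\<bar> powr (p / 2))\<^sup>2
    \<le> (a - b) * (signed_powr (p - 1) a - signed_powr (p - 1) b)" (is "?L a b \<le> ?R a b")
proof -
  have coeff: "0 \<le> 4 * (p - 1) / p\<^sup>2" "4 * (p - 1) / p\<^sup>2 \<le> 1"
    using assms zero_le_power2[of "p - 2"] by (auto simp: field_simps power2_eq_square)
  have opposite: "?L a b \<le> ?R a b" if "a \<ge> 0" "b \<le> 0" for a b :: real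
  proof -
    have sq: "(\<bar>x\<bar> powr (p / 2))\<^sup>2 = x * signed_powr (p - 1) x" for x
      using assms by (simp add: signed_powr_mult_self power2_eq_square flip: powr_add)
    have "?L a b \<le> (\<bar>a\<bar> powr (p / 2) - \<bar>b\<bar> powr (p / 2))\<^sup>2"
      using mult_right_mono[OF coeff(2) zero_le_power2] by simp
    also have "\<dots> \<le> (\<bar>a\<bar> powr (p / 2))\<^sup>2 + (\<bar>b\<bar> powr (p / 2))\<^sup>2"
      by (simp add: power2_diff)
    also have "\<dots> \<le> ?R a b"
    proof -
      have "signed_powr (p - 1) b \<le> 0" "0 \<le> signed_powr (p - 1) a"
        using that by (auto simp: signed_powr_def sgn_if)
      then have "a * signed_powr (p - 1) b \<le> 0" "b * signed_powr (p - 1) a \<le> 0"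
        using that by (auto intro: mult_nonneg_nonpos mult_nonpos_nonneg)
      then show ?thesis by (simp add: sq algebra_simps)
    qed
    finally show ?thesis .
  qed
  have sym: "?L b a = ?L a b" "?R b a = ?R a b" for a b
    by (auto simp: power2_commute algebra_simps)
  have neg: "?L (- a) (- b) = ?L a b" "?R (- a) (- b) = ?R a b" for a b
    by (auto simp: algebra_simps)
  have positive: "?L a b \<le> ?R a b" if "a > 0" "b > 0" for a b :: real
  proof -
    consider "b < a" | "a < b" | "a = b" by linarith
    then show ?thesis
    proof cases
      case 1
      then show ?thesis using powr_difference_bound[OF assms that(2) 1] that by (simp add: signed_powr_def)
    next
      case 2
      have "?L b a \<le> ?R b a"
        using powr_difference_bound[OF assms that(1) 2] that by (simp add: signed_powr_def)
      then show ?thesis by (simp only: sym)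
    qed simp
  qed
  consider "a > 0" "b > 0" | "a < 0" "b < 0" | "a \<ge> 0" "b \<le> 0" | "b \<ge> 0" "a \<le> 0" by linarith
  then show ?thesis
  proof cases
    case 1 then show ?thesis by (rule positive)
  next
    case 2
    then have "?L (- a) (- b) \<le> ?R (- a) (- b)" by (intro positive) auto
    then show ?thesis by (simp only: neg)
  next
    case 3 then show ?thesis by (rule opposite)
  next
    case 4
    then have "?L b a \<le> ?R b a" by (rule opposite)
    then show ?thesis by (simp only: sym)
  qed
qed

text \<open>Bernoulli's inequality, obtained from Young's inequality for \<open>y powr r\<close> and
  1 with weights \<open>1 / r\<close> and \<open>1 - 1 / r\<close>.\<close>

lemma powr_ge_tangent_at_1:
  fixes y r :: real
  assumes "y > 0" "r \<ge> 1"
  shows "1 + r * (y - 1) \<le> y powr r"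
proof -
  have "(y powr r) powr (1 / r) * 1 powr (1 - 1 / r) \<le> (1 / r) * y powr r + (1 - 1 / r) * 1"
    using assms by (intro Youngs_inequality_0) auto
  then have "y \<le> (1 / r) * y powr r + (1 - 1 / r)"
    using assms by (simp add: powr_powr)
  then have "r * y \<le> r * ((1 / r) * y powr r + (1 - 1 / r))"
    using assms by (intro mult_left_mono) auto
  also have "\<dots> = y powr r + r - 1"
    using assms by (simp add: distrib_left right_diff_distrib)
  finally show ?thesis by (simp add: right_diff_distrib)
qed

lemma powr_le_tangent_at_1:
  fixes y r :: real
  assumes "y > 0" "0 \<le> r" "r \<le> 1"
  shows "y powr r \<le> 1 + r * (y - 1)"
  using Youngs_inequality_0[of r "1 - r" y 1] assms by (simp add: algebra_simps)

text \<open>Log-convexity of moments. After division by \<open>X\<close> and \<open>Y\<close>,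
  Young's inequality holds pointwise, and its right-hand side sums to u + (1 - u) = 1. If every term
  vanishes this normalization is impossible, hence the case split.\<close>

lemma sum_powr_interpolation:
  fixes m w :: "'a \<Rightarrow> real"
  assumes fin: "finite T" and m: "\<And>x. x \<in> T \<Longrightarrow> m x \<ge> 0"
    and u: "0 \<le> u" "u \<le> 1" and r: "r = u * r1 + (1 - u) * r2"
  shows "(\<Sum>x\<in>T. m x * \<bar>w x\<bar> powr r)
    \<le> (\<Sum>x\<in>T. m x * \<bar>w x\<bar> powr r1) powr u * (\<Sum>x\<in>T. m x * \<bar>w x\<bar> powr r2) powr (1 - u)"
    (is "_ \<le> ?X powr u * ?Y powr (1 - u)")
proof (cases "\<exists>x\<in>T. m x * \<bar>w x\<bar> \<noteq> 0")
  case False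
  then have "(\<Sum>x\<in>T. m x * \<bar>w x\<bar> powr r) = 0" by (intro sum.neutral) auto
  then show ?thesis by simp
next
  case True
  then obtain z where z: "z \<in> T" "m z > 0" "\<bar>w z\<bar> > 0" using m by force
  then have "m z * \<bar>w z\<bar> powr s > 0" for s by simp
  then have pos: "(\<Sum>x\<in>T. m x * \<bar>w x\<bar> powr s) > 0" for s
    using z(1) fin m by (intro sum_pos2[of T z]) auto
  define X Y where "X = ?X" and "Y = ?Y"
  have XY: "X > 0" "Y > 0" using pos by (auto simp: X_def Y_def)
  have "(\<Sum>x\<in>T. m x * \<bar>w x\<bar> powr r)
      \<le> (\<Sum>x\<in>T. X powr u * Y powr (1 - u) * (u * (m x * \<bar>w x\<bar> powr r1 / X) + (1 - u) * (m x * \<bar>w x\<bar> powr r2 / Y)))"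
  proof (rule sum_mono)
    fix x assume x: "x \<in> T"
    show "m x * \<bar>w x\<bar> powr r \<le> X powr u * Y powr (1 - u) * (u * (m x * \<bar>w x\<bar> powr r1 / X) + (1 - u) * (m x * \<bar>w x\<bar> powr r2 / Y))"
    proof (cases "w x = 0")
      case True
      then show ?thesis by simp
    next
      case False
      have "(\<bar>w x\<bar> powr r1 / X) powr u * (\<bar>w x\<bar> powr r2 / Y) powr (1 - u)
          \<le> u * (\<bar>w x\<bar> powr r1 / X) + (1 - u) * (\<bar>w x\<bar> powr r2 / Y)"
        using u XY False by (intro Youngs_inequality_0) auto
      also have "(\<bar>w x\<bar> powr r1 / X) powr u * (\<bar>w x\<bar> powr r2 / Y) powr (1 - u)
          = \<bar>w x\<bar> powr r / (X powr u * Y powr (1 - u))"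
        using XY by (simp add: powr_divide powr_powr r mult.commute flip: powr_add)
      finally have "\<bar>w x\<bar> powr r \<le> X powr u * Y powr (1 - u) *
          (u * (\<bar>w x\<bar> powr r1 / X) + (1 - u) * (\<bar>w x\<bar> powr r2 / Y))"
        using XY by (simp add: divide_le_eq mult.commute)
      from mult_left_mono[OF this m[OF x]] show ?thesis
        by (simp add: algebra_simps)
    qed
  qed
  also have "\<dots> = X powr u * Y powr (1 - u) * (u * (?X / X) + (1 - u) * (?Y / Y))"
    by (simp add: sum_distrib_left sum.distrib sum_divide_distrib algebra_simps)
  also have "\<dots> = ?X powr u * ?Y powr (1 - u)"
    using XY by (simp flip: X_def Y_def)
  finally show ?thesis .
qed

lemma Lp_mono_prob:
  fixes m w :: "'a \<Rightarrow> real"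
  assumes fin: "finite T" and m: "\<And>x. x \<in> T \<Longrightarrow> m x \<ge> 0" "sum m T = 1"
    and r: "0 < r" "r \<le> p"
  shows "(\<Sum>x\<in>T. m x * \<bar>w x\<bar> powr r) \<le> (\<Sum>x\<in>T. m x * \<bar>w x\<bar> powr p) powr (r / p)"
proof -
  have "(\<Sum>x\<in>T. m x * \<bar>w x\<bar> powr r) \<le> (\<Sum>x\<in>T. m x * \<bar>w x\<bar> powr p) powr (r / p)
      * (\<Sum>x\<in>T. m x * \<bar>w x\<bar> powr 0) powr (1 - r / p)"
    using r by (intro sum_powr_interpolation fin m) auto
  also have "\<dots> \<le> (\<Sum>x\<in>T. m x * \<bar>w x\<bar> powr p) powr (r / p) * 1"
  proof (intro mult_left_mono powr_ge_zero)
    \<comment> \<open>Since \<open>0 powr 0 = 0\<close>, the moment of order 0 is the mass of the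
      support of \<open>w\<close>, which may be less than 1.\<close>
    have "(\<Sum>x\<in>T. m x * \<bar>w x\<bar> powr 0) \<le> sum m T"
      using m by (intro sum_mono) auto
    then have "(\<Sum>x\<in>T. m x * \<bar>w x\<bar> powr 0) powr (1 - r / p) \<le> 1 powr (1 - r / p)"
      using r m by (intro powr_mono2) (auto intro!: sum_nonneg)
    then show "(\<Sum>x\<in>T. m x * \<bar>w x\<bar> powr 0) powr (1 - r / p) \<le> 1" by simp
  qed
  finally show ?thesis by simp
qed

section \<open>Comparison principles on a time interval, run backwards from its right end\<close>

lemma nondecreasing_on_interval:
  fixes y y' :: "real \<Rightarrow> real"
  assumes deriv: "\<And>r. r \<in> {a..b} \<Longrightarrow> (y has_real_derivative y' r) (at r within {a..b})"
    and nonneg: "\<And>r. r \<in> {a..b} \<Longrightarrow> y' r \<ge> 0"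
    and s: "a \<le> s" "s \<le> b"
  shows "y s \<le> y b"
proof (cases "s < b")
  case True
  have "(y has_derivative (*) (y' r)) (at r within {s..b})" if "r \<in> {s..b}" for r
    using has_field_derivative_subset[OF deriv, of r "{s..b}"] that s
    by (simp add: has_field_derivative_def)
  from mvt_simple[OF True this] obtain r where "r \<in> {s<..<b}" "y b - y s = y' r * (b - s)" by auto
  moreover from this have "y' r * (b - s) \<ge> 0"
    using nonneg[of r] s by (intro mult_nonneg_nonneg) auto
  ultimately show ?thesis by simp
qed (use s in auto)

text \<open>A sign of the derivative is demanded only above the level \<open>c\<close>. This is what
  makes nonlinear inequalities tractable: above the barrier the terminal data can be estimated by
  the current value.\<close>

lemma stays_below:
  fixes y :: "real \<Rightarrow> real"
  assumes cont: "continuous_on {a..b} y"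
    and deriv: "\<And>r. r \<in> {a..b} \<Longrightarrow> y r > c \<Longrightarrow>
      \<exists>d\<ge>0. (y has_real_derivative d) (at r within {a..b})"
    and s: "s \<in> {a..b}" and yb: "y b \<le> c"
  shows "y s \<le> c"
proof (rule ccontr)
  assume ys: "\<not> y s \<le> c"
  \<comment> \<open>Its least element is the first time from \<open>s\<close> on at which
    \<open>y\<close> is at most \<open>c\<close>. Before it \<open>y\<close> stays above
    \<open>c\<close> and is nondecreasing, so \<open>y s\<close> could not have exceeded
    \<open>c\<close>.\<close>
  define R where "R = {r \<in> {s..b}. y r \<le> c}"
  have cont': "continuous_on {s..b} y" using s by (intro continuous_on_subset[OF cont]) auto
  have "closed ({s..b} \<inter> y -` {..c})"
    by (intro continuous_closed_preimage cont') auto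
  moreover have "{s..b} \<inter> y -` {..c} = R" by (auto simp: R_def)
  ultimately have "closed R" by simp
  moreover have "R \<subseteq> {s..b}" by (auto simp: R_def)
  ultimately have "compact R" by (meson bounded_closed_interval bounded_subset compact_eq_bounded_closed)
  moreover have "b \<in> R" using s yb by (auto simp: R_def)
  ultimately obtain r where r: "r \<in> R" "\<And>r'. r' \<in> R \<Longrightarrow> r \<le> r'"
    using compact_attains_inf by (metis empty_iff)
  then have sr: "s < r" "r \<le> b" using ys by (auto simp: R_def less_le)
  have above: "y r' > c" if "s \<le> r'" "r' < r" for r'
    using r(2)[of r'] that sr by (force simp: R_def)
  have "y s \<le> y r"
  proof (rule DERIV_nonneg_imp_increasing_open[where f = y])
    fix x assume x: "s < x" "x < r"
    then have "x \<in> {a..b}" "c < y x" using above s sr by auto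
    then obtain d where "d \<ge> 0" "(y has_real_derivative d) (at x within {a..b})" using deriv by blast
    moreover have "at x within {a..b} = at x" using x s sr by (intro at_within_interior) auto
    ultimately show "\<exists>d. (y has_real_derivative d) (at x) \<and> d \<ge> 0" by auto
  qed (use sr in \<open>auto intro: continuous_on_subset[OF cont']\<close>)
  then show False using r(1) ys by (auto simp: R_def)
qed

section \<open>Moments along a reversible Feynman-Kac flow\<close>

text \<open>The situation left after conditioning and normalizing: everything lives on
  \<open>T\<close>, and \<open>h\<close> has mean zero under \<open>m\<close>. The uniform bound on
  \<open>h\<close> serves the passage to the first moment.\<close>

locale fk_flow =
  fixes T :: "'a set" and t :: real
    and m h w :: "real \<Rightarrow> 'a \<Rightarrow> real"
    and Q :: "real \<Rightarrow> 'a \<Rightarrow> 'a \<Rightarrow> real"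
    and lam :: "real \<Rightarrow> real"
  assumes finite_T: "finite T"
    and m_pos: "s \<in> {0..t} \<Longrightarrow> x \<in> T \<Longrightarrow> m s x > 0"
    and m_sum: "s \<in> {0..t} \<Longrightarrow> (\<Sum>x\<in>T. m s x) = 1"
    and h_mean: "s \<in> {0..t} \<Longrightarrow> (\<Sum>x\<in>T. m s x * h s x) = 0"
    and h_bounded: "\<exists>K. \<forall>s\<in>{0..t}. \<forall>x\<in>T. \<bar>h s x\<bar> \<le> K"
    and m_deriv: "s \<in> {0..t} \<Longrightarrow> x \<in> T \<Longrightarrow>
      ((\<lambda>s. m s x) has_real_derivative - h s x * m s x) (at s within {0..t})"
    and Q_nonneg: "s \<in> {0..t} \<Longrightarrow> x \<in> T \<Longrightarrow> y \<in> T \<Longrightarrow> x \<noteq> y \<Longrightarrow> Q s x y \<ge> 0"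
    and Q_sum: "s \<in> {0..t} \<Longrightarrow> x \<in> T \<Longrightarrow> (\<Sum>y\<in>T. Q s x y) = 0"
    and Q_sym: "s \<in> {0..t} \<Longrightarrow> x \<in> T \<Longrightarrow> y \<in> T \<Longrightarrow> m s x * Q s x y = m s y * Q s y x"
    and lam_nonneg: "s \<in> {0..t} \<Longrightarrow> lam s \<ge> 0"
    and w_deriv: "s \<in> {0..t} \<Longrightarrow> x \<in> T \<Longrightarrow>
      ((\<lambda>s. w s x) has_real_derivative
        - (lam s * (\<Sum>y\<in>T. Q s x y * w s y)) + h s x * w s x) (at s within {0..t})"
begin

definition avg :: "real \<Rightarrow> ('a \<Rightarrow> real) \<Rightarrow> real" where
  "avg s f = (\<Sum>x\<in>T. m s x * f x)"

text \<open>Bilinear, because differentiating a moment pairs the solution with a nonlinear function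
  of itself.\<close>

definition form :: "real \<Rightarrow> ('a \<Rightarrow> real) \<Rightarrow> ('a \<Rightarrow> real) \<Rightarrow> real" where
  "form s f g = - avg s (\<lambda>x. f x * (\<Sum>y\<in>T. Q s x y * g y))"

definition moment :: "real \<Rightarrow> real \<Rightarrow> real" where
  "moment p s = avg s (\<lambda>x. \<bar>w s x\<bar> powr p)"

text \<open>Zero row sums remove the diagonal products and reversibility identifies the two mixed
  ones. In this shape inequalities between increments on pairs of points pass to the forms.\<close>

lemma form_eq:
  assumes s: "s \<in> {0..t}"
  shows "form s f g = (\<Sum>x\<in>T. \<Sum>y\<in>T. m s x * Q s x y * ((f x - f y) * (g x - g y))) / 2"
proof -
  have diag: "(\<Sum>x\<in>T. \<Sum>y\<in>T. m s x * Q s x y * k x) = 0" for k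
  proof -
    have "(\<Sum>x\<in>T. \<Sum>y\<in>T. m s x * Q s x y * k x) = (\<Sum>x\<in>T. m s x * k x * (\<Sum>y\<in>T. Q s x y))"
      by (simp add: sum_distrib_left mult.commute mult.left_commute)
    then show ?thesis using Q_sum s by simp
  qed
  have swap: "(\<Sum>x\<in>T. \<Sum>y\<in>T. m s x * Q s x y * k y x) = (\<Sum>x\<in>T. \<Sum>y\<in>T. m s x * Q s x y * k x y)" for k
    by (subst sum.swap) (intro sum.cong refl, simp add: Q_sym[OF s])
  have off: "(\<Sum>x\<in>T. \<Sum>y\<in>T. m s x * Q s x y * (f x * g y)) = - form s f g"
    by (simp add: form_def avg_def sum_distrib_left mult.commute mult.left_commute)
  have "(\<Sum>x\<in>T. \<Sum>y\<in>T. m s x * Q s x y * ((f x - f y) * (g x - g y)))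
    = (\<Sum>x\<in>T. \<Sum>y\<in>T. m s x * Q s x y * (f x * g x)) + (\<Sum>x\<in>T. \<Sum>y\<in>T. m s x * Q s x y * (f y * g y))
      - (\<Sum>x\<in>T. \<Sum>y\<in>T. m s x * Q s x y * (f x * g y)) - (\<Sum>x\<in>T. \<Sum>y\<in>T. m s x * Q s x y * (f y * g x))"
    by (simp add: right_diff_distrib left_diff_distrib sum.distrib sum_subtractf flip: mult.assoc)
  also have "\<dots> = 2 * form s f g"
    using swap[of "\<lambda>x y. f x * g x"] swap[of "\<lambda>x y. f x * g y"] diag[of "\<lambda>x. f x * g x"] off by simp
  finally show ?thesis by simp
qed

lemma form_ge:
  assumes s: "s \<in> {0..t}"
    and le: "\<And>x y. x \<in> T \<Longrightarrow> y \<in> T \<Longrightarrow> c * (k x - k y)\<^sup>2 \<le> (f x - f y) * (g x - g y)"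
  shows "c * form s k k \<le> form s f g"
proof -
  have "(\<Sum>x\<in>T. \<Sum>y\<in>T. m s x * Q s x y * (c * ((k x - k y) * (k x - k y))))
      \<le> (\<Sum>x\<in>T. \<Sum>y\<in>T. m s x * Q s x y * ((f x - f y) * (g x - g y)))"
  proof (intro sum_mono)
    fix x y assume xy: "x \<in> T" "y \<in> T"
    show "m s x * Q s x y * (c * ((k x - k y) * (k x - k y))) \<le> m s x * Q s x y * ((f x - f y) * (g x - g y))"
    \<comment> \<open>The diagonal entries of \<open>Q\<close> have the wrong sign, but the
      increments vanish there.\<close>
    proof (cases "x = y")
      case False
      then have "0 \<le> m s x * Q s x y" using Q_nonneg m_pos s xy by (simp add: less_imp_le)
      then show ?thesis using le[OF xy] by (intro mult_left_mono) (auto simp: power2_eq_square)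
    qed simp
  qed
  also have "(\<Sum>x\<in>T. \<Sum>y\<in>T. m s x * Q s x y * (c * ((k x - k y) * (k x - k y))))
      = c * (\<Sum>x\<in>T. \<Sum>y\<in>T. m s x * Q s x y * ((k x - k y) * (k x - k y)))"
    by (simp add: sum_distrib_left mult.left_commute)
  finally show ?thesis by (simp add: form_eq[OF s])
qed

lemma form_mono_nonneg:
  assumes "s \<in> {0..t}"
    and "\<And>x y. x \<in> T \<Longrightarrow> y \<in> T \<Longrightarrow> 0 \<le> (f x - f y) * (g x - g y)"
  shows "0 \<le> form s f g"
  using form_ge[OF assms(1), of 0 "\<lambda>_. 0"] assms(2) by simp

lemma form_nonneg: "s \<in> {0..t} \<Longrightarrow> 0 \<le> form s f f"
  by (rule form_mono_nonneg) auto

lemma variance_eq: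
  assumes s: "s \<in> {0..t}"
  shows "avg s (\<lambda>x. (f x - avg s f)\<^sup>2) = avg s (\<lambda>x. (f x)\<^sup>2) - (avg s f)\<^sup>2"
proof -
  define a where "a = avg s f"
  have "avg s (\<lambda>x. (f x - a)\<^sup>2) = avg s (\<lambda>x. (f x)\<^sup>2) - 2 * a * avg s f + a\<^sup>2 * (\<Sum>x\<in>T. m s x)"
    unfolding avg_def sum_distrib_left sum_subtractf[symmetric] sum.distrib[symmetric]
    by (intro sum.cong refl) (simp add: power2_diff algebra_simps)
  then show ?thesis by (simp add: m_sum[OF s] a_def[symmetric]) (simp add: power2_eq_square)
qed

text \<open>Separates the part governed by \<open>A\<close> from the linear part governed by
  \<open>B\<close>. The term with the squared mean drops out because \<open>h\<close> is
  centred.\<close>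

lemma avg_h_square:
  assumes s: "s \<in> {0..t}"
  shows "avg s (\<lambda>x. h s x * (f x)\<^sup>2)
    = avg s (\<lambda>x. h s x * (f x - avg s f)\<^sup>2) + 2 * avg s f * avg s (\<lambda>x. h s x * f x)"
proof -
  define a where "a = avg s f"
  have "avg s (\<lambda>x. h s x * (f x - a)\<^sup>2)
      = avg s (\<lambda>x. h s x * (f x)\<^sup>2) - 2 * a * avg s (\<lambda>x. h s x * f x) + a\<^sup>2 * (\<Sum>x\<in>T. m s x * h s x)"
    unfolding avg_def sum_distrib_left sum_subtractf[symmetric] sum.distrib[symmetric]
    by (intro sum.cong refl) (simp add: power2_diff algebra_simps)
  then show ?thesis by (simp add: h_mean[OF s] a_def[symmetric])
qed

lemma moment_nonneg: "s \<in> {0..t} \<Longrightarrow> 0 \<le> moment p s"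
  using m_pos by (auto simp: moment_def avg_def less_imp_le intro!: sum_nonneg)

lemma moment_2: "moment 2 s = avg s (\<lambda>x. (w s x)\<^sup>2)"
  by (simp add: moment_def)

text \<open>The density contributes \<open>- h * F(w)\<close> and the chain rule contributes
  \<open>h * F'(w) * w\<close>; their sum vanishes for \<open>F\<close> homogeneous of degree
  1.\<close>

lemma avg_has_derivative:
  assumes s: "s \<in> {0..t}"
    and F: "\<And>x. x \<in> T \<Longrightarrow> (F has_real_derivative F' x) (at (w s x))"
  shows "((\<lambda>s. avg s (\<lambda>x. F (w s x))) has_real_derivative
    lam s * form s F' (w s) + avg s (\<lambda>x. h s x * (F' x * w s x - F (w s x)))) (at s within {0..t})"
proof -
  have "((\<lambda>s. m s x * F (w s x)) has_real_derivative
      (- h s x * m s x) * F (w s x)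
      + F' x * (- (lam s * (\<Sum>y\<in>T. Q s x y * w s y)) + h s x * w s x) * m s x) (at s within {0..t})"
    if "x \<in> T" for x
    by (intro DERIV_mult m_deriv s that DERIV_chain2[where f = F] F w_deriv)
  then have "((\<lambda>s. \<Sum>x\<in>T. m s x * F (w s x)) has_real_derivative
      (\<Sum>x\<in>T. (- h s x * m s x) * F (w s x)
      + F' x * (- (lam s * (\<Sum>y\<in>T. Q s x y * w s y)) + h s x * w s x) * m s x)) (at s within {0..t})"
    by (intro DERIV_sum)
  moreover have "(\<Sum>x\<in>T. (- h s x * m s x) * F (w s x) + F' x * (- (lam s * R x) + h s x * w s x) * m s x)
    = lam s * - (\<Sum>x\<in>T. m s x * (F' x * R x))
      + (\<Sum>x\<in>T. m s x * (h s x * (F' x * w s x - F (w s x))))" for R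
    unfolding sum_negf[symmetric] sum_distrib_left sum.distrib[symmetric]
    by (intro sum.cong refl) (simp add: algebra_simps)
  ultimately show ?thesis by (simp add: avg_def form_def)
qed

lemma moment_has_derivative:
  assumes s: "s \<in> {0..t}" and p: "p > 1"
  shows "(moment p has_real_derivative
    p * lam s * form s (\<lambda>x. signed_powr (p - 1) (w s x)) (w s)
    + (p - 1) * avg s (\<lambda>x. h s x * \<bar>w s x\<bar> powr p)) (at s within {0..t})"
proof -
  have "(moment p has_real_derivative
      lam s * form s (\<lambda>x. p * signed_powr (p - 1) (w s x)) (w s)
      + avg s (\<lambda>x. h s x * (p * signed_powr (p - 1) (w s x) * w s x - \<bar>w s x\<bar> powr p))) (at s within {0..t})"
    unfolding moment_def by (intro avg_has_derivative s has_real_derivative_abs_powr p)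
  moreover have "form s (\<lambda>x. p * signed_powr (p - 1) (w s x)) (w s)
      = p * form s (\<lambda>x. signed_powr (p - 1) (w s x)) (w s)"
    by (simp add: form_def avg_def sum_distrib_left algebra_simps)
  moreover have "p * signed_powr (p - 1) x * x - \<bar>x\<bar> powr p = (p - 1) * \<bar>x\<bar> powr p" for x
    using signed_powr_mult_self[of x "p - 1"] by (simp add: algebra_simps)
  then have "avg s (\<lambda>x. h s x * (p * signed_powr (p - 1) (w s x) * w s x - \<bar>w s x\<bar> powr p))
      = (p - 1) * avg s (\<lambda>x. h s x * \<bar>w s x\<bar> powr p)"
    by (simp add: avg_def sum_distrib_left mult.left_commute)
  ultimately show ?thesis by (simp add: mult.assoc mult.left_commute)
qed

lemma avg_conserved:
  assumes s: "s \<in> {0..t}"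
  shows "avg s (w s) = avg t (w t)"
proof -
  have d: "((\<lambda>s. avg s (w s)) has_real_derivative 0) (at r within {0..t})" if r: "r \<in> {0..t}" for r
  proof -
    have "form r (\<lambda>_. 1) (w r) = 0" by (simp add: form_eq[OF r])
    then show ?thesis
      using avg_has_derivative[OF r, of "\<lambda>x. x" "\<lambda>_. 1"] by (simp add: avg_def)
  qed
  have d': "((\<lambda>s. - avg s (w s)) has_real_derivative 0) (at r within {0..t})" if "r \<in> {0..t}" for r
    using DERIV_minus[OF d[OF that]] by simp
  show ?thesis
    using nondecreasing_on_interval[where y = "\<lambda>s. avg s (w s)", OF d, of s]
      nondecreasing_on_interval[where y = "\<lambda>s. - avg s (w s)", OF d', of s] s by simp
qed

text \<open>The absolute value is not differentiable at 0, so orders \<open>q > 1\<close> are used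
  and \<open>q\<close> tends to 1. The potential then costs at most \<open>(q - 1) * K\<close> times
  the moment; the exponential factor compensates for this and disappears in the limit.\<close>

lemma moment_1_contraction:
  assumes s: "s \<in> {0..t}"
  shows "moment 1 s \<le> moment 1 t"
proof -
  obtain K where K: "\<And>r x. r \<in> {0..t} \<Longrightarrow> x \<in> T \<Longrightarrow> \<bar>h r x\<bar> \<le> K" using h_bounded by blast
  have lim: "((\<lambda>q. moment q r) \<longlongrightarrow> moment 1 r) (at_right 1)" for r
    unfolding moment_def avg_def
  proof (intro tendsto_sum tendsto_mult tendsto_const)
    fix x
    show "((\<lambda>q. \<bar>w r x\<bar> powr q) \<longlongrightarrow> \<bar>w r x\<bar> powr 1) (at_right 1)"
      by (cases "w r x = 0") (simp, intro tendsto_intros, simp)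
  qed
  have bound: "exp ((q - 1) * K * s) * moment q s \<le> exp ((q - 1) * K * t) * moment q t" if q: "q > 1" for q
  proof -
    let ?d = "\<lambda>r. q * lam r * form r (\<lambda>x. signed_powr (q - 1) (w r x)) (w r)
      + (q - 1) * avg r (\<lambda>x. h r x * \<bar>w r x\<bar> powr q)"
    show ?thesis
    proof (rule nondecreasing_on_interval[where y = "\<lambda>r. exp ((q - 1) * K * r) * moment q r"
          and y' = "\<lambda>r. exp ((q - 1) * K * r) * ((q - 1) * K * moment q r + ?d r)" and a = 0])
      fix r assume r: "r \<in> {0..t}"
      show "((\<lambda>r. exp ((q - 1) * K * r) * moment q r) has_real_derivative
          exp ((q - 1) * K * r) * ((q - 1) * K * moment q r + ?d r)) (at r within {0..t})"
        by (auto intro!: derivative_eq_intros moment_has_derivative r q simp: algebra_simps)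
      have form: "0 \<le> form r (\<lambda>x. signed_powr (q - 1) (w r x)) (w r)"
      proof (rule form_mono_nonneg[OF r])
        fix x y
        show "0 \<le> (signed_powr (q - 1) (w r x) - signed_powr (q - 1) (w r y)) * (w r x - w r y)"
          using signed_powr_mono[of "q - 1" "w r x" "w r y"] signed_powr_mono[of "q - 1" "w r y" "w r x"] q
          by (cases "w r x \<le> w r y") (auto intro: mult_nonneg_nonneg mult_nonpos_nonpos)
      qed
      have "0 \<le> K * moment q r + avg r (\<lambda>x. h r x * \<bar>w r x\<bar> powr q)"
      proof -
        have "0 \<le> avg r (\<lambda>x. (K + h r x) * \<bar>w r x\<bar> powr q)"
          unfolding avg_def using m_pos[OF r] K[OF r]
          by (intro sum_nonneg mult_nonneg_nonneg) (force simp: less_imp_le)+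
        then show ?thesis
          by (simp add: moment_def avg_def sum_distrib_left sum.distrib algebra_simps)
      qed
      then have "0 \<le> (q - 1) * (K * moment q r + avg r (\<lambda>x. h r x * \<bar>w r x\<bar> powr q))"
        using q by simp
      moreover have "0 \<le> q * lam r * form r (\<lambda>x. signed_powr (q - 1) (w r x)) (w r)"
        using q lam_nonneg[OF r] form by simp
      ultimately have "0 \<le> (q - 1) * K * moment q r + ?d r"
        by (simp add: distrib_left mult.assoc)
      then show "0 \<le> exp ((q - 1) * K * r) * ((q - 1) * K * moment q r + ?d r)"
        by (intro mult_nonneg_nonneg) auto
    qed (use s in auto)
  qed
  have "exp ((1 - 1) * K * s) * moment 1 s \<le> exp ((1 - 1) * K * t) * moment 1 t"
  proof (rule tendsto_le)
    show "((\<lambda>q. exp ((q - 1) * K * s) * moment q s) \<longlongrightarrow> exp ((1 - 1) * K * s) * moment 1 s) (at_right 1)"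
      by (intro tendsto_intros lim)
    show "((\<lambda>q. exp ((q - 1) * K * t) * moment q t) \<longlongrightarrow> exp ((1 - 1) * K * t) * moment 1 t) (at_right 1)"
      by (intro tendsto_intros lim)
    show "eventually (\<lambda>q. exp ((q - 1) * K * s) * moment q s \<le> exp ((q - 1) * K * t) * moment q t) (at_right 1)"
      using bound by (auto simp: eventually_at_filter)
  qed simp
  then show ?thesis by simp
qed

end

section \<open>Decay and growth estimates\<close>

locale fk_flow_inequalities = fk_flow +
  fixes A B C :: "real \<Rightarrow> real"
  assumes poincare: "s \<in> {0..t} \<Longrightarrow> avg s (\<lambda>x. (f x - avg s f)\<^sup>2) \<le> C s * form s f f"
    and potential_A: "s \<in> {0..t} \<Longrightarrow> - avg s (\<lambda>x. h s x * (f x - avg s f)\<^sup>2) \<le> A s * form s f f"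
    and potential_B: "s \<in> {0..t} \<Longrightarrow> (avg s (\<lambda>x. h s x * f x))\<^sup>2 \<le> B s * form s f f"
begin

text \<open>Stroock-Varopoulos turns \<open>p * lam s * E\<close> into at least (p - 1) * (4 * lam s
  / p) times the form of \<open>g\<close>, which explains the factor \<open>p / 4\<close> in the
  hypothesis. Of this amount \<open>A s\<close> pays for the centred potential,
  \<open>\<kappa> * B s\<close> for the cross term, and \<open>2 * \<alpha> * C s\<close> leaves a
  multiple of the variance of \<open>g\<close> as surplus.\<close>

lemma moment_derivative_ge:
  assumes s: "s \<in> {0..t}" and p: "p \<ge> 2" and \<kappa>: "\<kappa> > 0" and \<alpha>: "\<alpha> \<ge> 0"
    and lam: "lam s \<ge> p / 4 * (A s + \<kappa> * B s + 2 * \<alpha> * C s)"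
  obtains d where "(moment p has_real_derivative d) (at s within {0..t})"
    "d \<ge> (p - 1) * (2 * \<alpha> * (moment p s - (moment (p / 2) s)\<^sup>2) - (moment (p / 2) s)\<^sup>2 / \<kappa>)"
proof
  define g where "g x = \<bar>w s x\<bar> powr (p / 2)" for x
  define e where "e = form s g g"
  define a where "a = avg s g"
  define b where "b = avg s (\<lambda>x. h s x * g x)"
  define X where "X = avg s (\<lambda>x. h s x * (g x - a)\<^sup>2)"
  define E where "E = form s (\<lambda>x. signed_powr (p - 1) (w s x)) (w s)"
  have g2: "(g x)\<^sup>2 = \<bar>w s x\<bar> powr p" for x
    by (simp add: g_def power2_eq_square flip: powr_add)
  have a: "moment (p / 2) s = a" by (simp add: a_def g_def[abs_def] moment_def)
  have V: "avg s (\<lambda>x. (g x - a)\<^sup>2) = moment p s - a\<^sup>2"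
    using variance_eq[OF s, of g] by (simp add: a_def g2 moment_def)
  have hg: "avg s (\<lambda>x. h s x * \<bar>w s x\<bar> powr p) = X + 2 * a * b"
    using avg_h_square[OF s, of g] by (simp add: a_def b_def X_def g2)
  have "4 * (p - 1) / p\<^sup>2 * e \<le> E"
    unfolding e_def E_def
  proof (rule form_ge[OF s])
    fix x y
    show "4 * (p - 1) / p\<^sup>2 * (g x - g y)\<^sup>2
        \<le> (signed_powr (p - 1) (w s x) - signed_powr (p - 1) (w s y)) * (w s x - w s y)"
      using stroock_varopoulos_scalar[of p "w s x" "w s y"] p by (simp add: g_def mult.commute)
  qed
  then have "p * lam s * (4 * (p - 1) / p\<^sup>2 * e) \<le> p * lam s * E"
    using lam_nonneg[OF s] p by (intro mult_left_mono) auto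
  also have "p * lam s * (4 * (p - 1) / p\<^sup>2 * e) = (p - 1) * (4 * lam s / p * e)"
    using p by (simp add: power2_eq_square)
  finally have E: "(p - 1) * (4 * lam s / p * e) \<le> p * lam s * E" .
  have "A s + \<kappa> * B s + 2 * \<alpha> * C s \<le> 4 * lam s / p"
    using lam p by (simp add: field_simps)
  then have "(A s + \<kappa> * B s + 2 * \<alpha> * C s) * e \<le> 4 * lam s / p * e"
    using form_nonneg[OF s, of g] by (intro mult_right_mono) (auto simp: e_def)
  moreover have "- X \<le> A s * e" using potential_A[OF s, of g] by (simp add: X_def a_def e_def)
  moreover have "\<kappa> * b\<^sup>2 \<le> \<kappa> * (B s * e)"
    using potential_B[OF s, of g] \<kappa> by (simp add: b_def e_def)
  moreover have "2 * \<alpha> * (moment p s - a\<^sup>2) \<le> 2 * \<alpha> * (C s * e)"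
    using poincare[OF s, of g] \<alpha> V by (intro mult_left_mono) (auto simp: a_def e_def)
  \<comment> \<open>Completing the square in \<open>b\<close>; \<open>\<kappa>\<close> sets how the
    cross term is shared between \<open>B\<close> and the remainder.\<close>
  moreover have "- (a\<^sup>2 / \<kappa>) \<le> \<kappa> * b\<^sup>2 + 2 * a * b"
  proof -
    have "0 \<le> (\<kappa> * b + a)\<^sup>2 / \<kappa>" using \<kappa> by simp
    also have "\<dots> = \<kappa> * b\<^sup>2 + 2 * a * b + a\<^sup>2 / \<kappa>"
      using \<kappa> by (simp add: power2_eq_square field_simps)
    finally show ?thesis by simp
  qed
  ultimately have "2 * \<alpha> * (moment p s - a\<^sup>2) - a\<^sup>2 / \<kappa> \<le> 4 * lam s / p * e + (X + 2 * a * b)"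
    by (simp add: distrib_right mult.assoc)
  then have "(p - 1) * (2 * \<alpha> * (moment p s - a\<^sup>2) - a\<^sup>2 / \<kappa>)
      \<le> (p - 1) * (4 * lam s / p * e + (X + 2 * a * b))"
    using p by (intro mult_left_mono) auto
  also have "\<dots> \<le> p * lam s * E + (p - 1) * (X + 2 * a * b)"
    using E by (simp only: distrib_left)
  finally show "(p - 1) * (2 * \<alpha> * (moment p s - (moment (p / 2) s)\<^sup>2) - (moment (p / 2) s)\<^sup>2 / \<kappa>)
      \<le> p * lam s * E + (p - 1) * (X + 2 * a * b)"
    unfolding a .
  show "(moment p has_real_derivative p * lam s * E + (p - 1) * (X + 2 * a * b)) (at s within {0..t})"
    using moment_has_derivative[OF s, of p] p unfolding hg E_def by simp
qed

text \<open>The case \<open>p = 2\<close> only uses the part \<open>2/p\<close> of the lower bound on \<open>lam\<close>. Passing to a smaller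
  multiple of a possibly negative bound is legitimate because \<open>lam\<close> itself is nonnegative.\<close>

lemma moment_2_decay:
  assumes p: "p \<ge> 2" and \<kappa>: "\<kappa> \<ge> 0" and \<alpha>: "\<alpha> \<ge> 0"
    and lam: "\<And>r. r \<in> {0..t} \<Longrightarrow> lam r \<ge> p / 4 * (A r + \<kappa> * B r + 2 * \<alpha> * C r)"
    and mean_zero: "avg t (w t) = 0"
    and s: "s \<in> {0..t}"
  shows "moment 2 s \<le> exp (- 2 * \<alpha> * (t - s)) * moment 2 t"
proof -
  let ?d = "\<lambda>r. 2 * lam r * form r (w r) (w r) + avg r (\<lambda>x. h r x * (w r x)\<^sup>2)"
  have d: "(moment 2 has_real_derivative ?d r) (at r within {0..t})" if "r \<in> {0..t}" for r
    using moment_has_derivative[OF that, of 2] by (simp add: signed_powr_def sgn_mult_abs)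
  have ge: "2 * \<alpha> * moment 2 r \<le> ?d r" if r: "r \<in> {0..t}" for r
  proof -
    define e where "e = form r (w r) (w r)"
    define M where "M = A r + \<kappa> * B r + 2 * \<alpha> * C r"
    have e: "e \<ge> 0" unfolding e_def by (rule form_nonneg[OF r])
    \<comment> \<open>With mean zero at all times the variance is the second moment, and the
      inequality with \<open>A\<close> covers the whole potential term: there is no cross
      term.\<close>
    have avg0: "avg r (w r) = 0" using avg_conserved[OF r] mean_zero by simp
    have "M * e \<le> 2 * lam r * e"
    proof (cases "M \<ge> 0")
      case True
      then have "1 / 2 * M \<le> p / 4 * M" using p by (intro mult_right_mono) auto
      then show ?thesis using lam[OF r] e by (intro mult_right_mono) (auto simp: M_def)
    next
      case False
      then have "M \<le> 2 * lam r" using lam_nonneg[OF r] by simp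
      then show ?thesis using e by (intro mult_right_mono) auto
    qed
    moreover have "- avg r (\<lambda>x. h r x * (w r x)\<^sup>2) \<le> A r * e"
      using potential_A[OF r, of "w r"] by (simp add: avg0 e_def)
    \<comment> \<open>\<open>B r * e\<close> dominates a square, so discarding the \<open>B\<close>
      part of \<open>M * e\<close> can only lower it.\<close>
    moreover have "0 \<le> \<kappa> * (B r * e)"
      using order_trans[OF zero_le_power2 potential_B[OF r, of "w r"]] \<kappa> by (simp add: e_def)
    moreover have "2 * \<alpha> * moment 2 r \<le> 2 * \<alpha> * (C r * e)"
      using poincare[OF r, of "w r"] \<alpha> by (intro mult_left_mono) (auto simp: avg0 e_def moment_2)
    ultimately show ?thesis by (simp add: M_def e_def[symmetric] distrib_right mult.assoc)
  qed
  have "exp (- 2 * \<alpha> * s) * moment 2 s \<le> exp (- 2 * \<alpha> * t) * moment 2 t"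
  proof (rule nondecreasing_on_interval[where y = "\<lambda>r. exp (- 2 * \<alpha> * r) * moment 2 r"
        and y' = "\<lambda>r. exp (- 2 * \<alpha> * r) * (?d r - 2 * \<alpha> * moment 2 r)" and a = 0])
    fix r assume r: "r \<in> {0..t}"
    show "((\<lambda>r. exp (- 2 * \<alpha> * r) * moment 2 r) has_real_derivative
        exp (- 2 * \<alpha> * r) * (?d r - 2 * \<alpha> * moment 2 r)) (at r within {0..t})"
      by (rule DERIV_cong, rule DERIV_mult[OF _ d[OF r]])
         (rule derivative_eq_intros refl | simp add: algebra_simps)+
    show "0 \<le> exp (- 2 * \<alpha> * r) * (?d r - 2 * \<alpha> * moment 2 r)"
      using ge[OF r] by simp
  qed (use s in auto)
  then have "exp (2 * \<alpha> * s) * (exp (- 2 * \<alpha> * s) * moment 2 s) \<le> exp (2 * \<alpha> * s) * (exp (- 2 * \<alpha> * t) * moment 2 t)"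
    by (intro mult_left_mono) auto
  then show ?thesis
    by (simp add: algebra_simps flip: mult.assoc exp_add)
qed

text \<open>The weight \<open>u\<close> solves p/2 = u * r1 + (1 - u) * p, and
  \<open>p \<ge> 2 * r1\<close> says that \<open>u \<le> 1\<close>. Squaring doubles the exponents.
  Applied with \<open>r1 = 1\<close> for growth and \<open>r1 = 2\<close> for decay.\<close>

lemma moment_interpolation:
  assumes s: "s \<in> {0..t}" and r1: "1 \<le> r1" "r1 < p" "p \<ge> 2 * r1"
  shows "(moment (p / 2) s)\<^sup>2
    \<le> moment r1 s powr (p / (p - r1)) * moment p s powr ((p - 2 * r1) / (p - r1))"
proof -
  define u where "u = p / (2 * (p - r1))"
  have u: "0 \<le> u" "u \<le> 1" "u + u = p / (p - r1)" "(1 - u) + (1 - u) = (p - 2 * r1) / (p - r1)"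
    "p / 2 = u * r1 + (1 - u) * p"
  proof -
    define k where "k = p - r1"
    have "p = r1 + k" "k > 0" "r1 \<le> k" using r1 by (auto simp: k_def)
    then show "0 \<le> u" "u \<le> 1" "u + u = p / (p - r1)" "(1 - u) + (1 - u) = (p - 2 * r1) / (p - r1)"
        "p / 2 = u * r1 + (1 - u) * p"
      using r1 by (auto simp: u_def field_simps)
  qed
  have "moment (p / 2) s \<le> moment r1 s powr u * moment p s powr (1 - u)"
    unfolding moment_def avg_def
    using u m_pos[OF s] by (intro sum_powr_interpolation finite_T) (auto simp: less_imp_le)
  then have "(moment (p / 2) s)\<^sup>2 \<le> (moment r1 s powr u * moment p s powr (1 - u))\<^sup>2"
    using moment_nonneg[OF s] by (intro power_mono) auto
  also have "\<dots> = moment r1 s powr (u + u) * moment p s powr ((1 - u) + (1 - u))"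
    by (simp only: powr_add power2_eq_square mult_ac)
  finally show ?thesis by (simp only: u)
qed

lemma moment_le_moment_powr:
  assumes s: "s \<in> {0..t}" and "0 < r" "r \<le> p"
  shows "moment r s \<le> moment p s powr (r / p)"
  unfolding moment_def avg_def using m_pos[OF s] m_sum[OF s] assms
  by (intro Lp_mono_prob finite_T) (auto simp: less_imp_le)

lemma moment_continuous:
  assumes "p > 1"
  shows "continuous_on {0..t} (moment p)"
  using moment_has_derivative[OF _ assms] by (intro DERIV_continuous_on)

text \<open>The rate of decay of the \<open>p\<close>-th moment is compared with the square of the moment of order
  \<open>p/2\<close>, which interpolates between the second moment (whose decay is known) and the \<open>p\<close>-th one.
  Bernoulli's inequality shows that \<open>(2 + 1/(\<alpha>\<beta>)) powr (p/2)\<close> is a barrier for the normalized moment.\<close>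

lemma moment_decay:
  assumes p: "p \<ge> 4" and \<alpha>: "\<alpha> > 0" and \<beta>: "\<beta> > 0"
    and lam: "\<And>r. r \<in> {0..t} \<Longrightarrow> lam r \<ge> p / 4 * (A r + \<beta> * (p - 1) / p * B r + 2 * \<alpha> * C r)"
    and mean_zero: "avg t (w t) = 0"
    and s: "s \<in> {0..t}"
  shows "moment p s \<le> (2 + 1 / (\<alpha> * \<beta>)) powr (p / 2) * exp (- \<alpha> * p * (t - s)) * moment p t"
proof -
  define c where "c = 2 + 1 / (\<alpha> * \<beta>)"
  define Y where "Y = c powr (p / 2)"
  \<comment> \<open>The interpolation exponents for \<open>r1 = 2\<close> are then
    \<open>1 + \<theta>\<close> and \<open>1 - \<theta>\<close>.\<close>
  define \<theta> where "\<theta> = 2 / (p - 2)"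
  define y where "y r = exp (\<alpha> * p * (t - r)) * moment p r" for r
  have c: "c > 2" using \<alpha> \<beta> by (simp add: c_def)
  have Y: "Y \<ge> 1" unfolding Y_def using c p by (intro ge_one_powr_ge_zero) auto
  have \<theta>: "\<theta> > 0" "p / (p - 2) = 1 + \<theta>" "(p - 2 * 2) / (p - 2) = 1 - \<theta>" "p * \<theta> = 2 * (1 + \<theta>)"
    using p by (auto simp: \<theta>_def field_simps)
  \<comment> \<open>The ratio on the left is the factor by which the p-th moment must exceed the
    squared moment of order p/2 to decay at rate \<open>\<alpha> * p\<close>. With
    \<open>c = 2 + 1 / (\<alpha> * \<beta>)\<close> it is the tangent at 1 of the power
    \<open>1 + \<theta>\<close>, evaluated at \<open>c\<close>.\<close>
  have barrier: "(2 * (p - 1) + p / (\<alpha> * \<beta>)) / (p - 2) \<le> Y powr \<theta>"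
  proof -
    have "(2 * (p - 1) + p / (\<alpha> * \<beta>)) / (p - 2) = 1 + (1 + \<theta>) * (c - 1)"
    proof -
      have "p / (\<alpha> * \<beta>) = p * (c - 2)" by (simp add: c_def)
      then show ?thesis using p by (simp add: \<theta>_def) (simp add: field_simps)
    qed
    also have "\<dots> \<le> c powr (1 + \<theta>)" using c \<theta> by (intro powr_ge_tangent_at_1) auto
    also have "1 + \<theta> = p / 2 * \<theta>" using \<theta>(4) by simp
    also have "c powr (p / 2 * \<theta>) = Y powr \<theta>" by (simp add: Y_def powr_powr)
    finally show ?thesis .
  qed
  have "y s \<le> Y * moment p t"
  proof (rule stays_below[where a = 0 and b = t and y = y])
    show "continuous_on {0..t} y"
      unfolding y_def[abs_def] using p by (intro continuous_intros moment_continuous) auto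
    show "y t \<le> Y * moment p t"
      using Y moment_nonneg[of t p] s by (simp add: y_def mult_le_cancel_right1)
  next
    fix r assume r: "r \<in> {0..t}" and above: "Y * moment p t < y r"
    \<comment> \<open>With this weight, \<open>p / 4\<close> times the coefficient of
      \<open>B\<close> is \<open>\<beta> * (p - 1) / 4\<close>.\<close>
    have \<kappa>: "\<beta> * (p - 1) / p > 0" using \<beta> p by simp
    define a where "a = moment (p / 2) r"
    obtain d where d: "(moment p has_real_derivative d) (at r within {0..t})"
      "d \<ge> (p - 1) * (2 * \<alpha> * (moment p r - a\<^sup>2) - a\<^sup>2 / (\<beta> * (p - 1) / p))"
      using moment_derivative_ge[OF r _ \<kappa> less_imp_le[OF \<alpha>] lam[OF r]] p unfolding a_def by auto
    \<comment> \<open>Being above the barrier trades the terminal moment for the current one; this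
      closes the estimate of \<open>a\<close>.\<close>
    have below: "exp (- \<alpha> * p * (t - r)) * moment p t \<le> moment p r / Y"
    proof -
      have "exp (- \<alpha> * p * (t - r)) * (Y * moment p t) \<le> exp (- \<alpha> * p * (t - r)) * y r"
        using above by simp
      also have "\<dots> = moment p r" by (simp add: y_def flip: mult.assoc exp_add)
      finally show ?thesis using Y by (simp add: le_divide_eq mult_ac)
    qed
    have pos: "moment p r > 0"
    proof -
      have "0 \<le> Y * moment p t" using Y moment_nonneg[of t p] s by simp
      then have "y r > 0" using above by simp
      then show ?thesis by (simp add: y_def zero_less_mult_iff)
    qed
    have "moment 2 r \<le> exp (- 2 * \<alpha> * (t - r)) * moment 2 t"
      using p \<kappa> \<alpha> by (intro moment_2_decay[OF _ _ _ lam mean_zero r]) auto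
    also have "\<dots> \<le> exp (- 2 * \<alpha> * (t - r)) * moment p t powr (2 / p)"
      using s p by (intro mult_left_mono moment_le_moment_powr) auto
    finally have "moment 2 r powr (1 + \<theta>) \<le> (exp (- 2 * \<alpha> * (t - r)) * moment p t powr (2 / p)) powr (1 + \<theta>)"
      using \<theta> moment_nonneg[OF r] by (intro powr_mono2) auto
    also have "\<dots> = (exp (- \<alpha> * p * (t - r)) * moment p t) powr \<theta>"
    proof -
      have e: "- 2 * \<alpha> * (t - r) * (1 + \<theta>) = - \<alpha> * p * (t - r) * \<theta>" "2 / p * (1 + \<theta>) = \<theta>"
      proof -
        have "- 2 * \<alpha> * (t - r) * (1 + \<theta>) = - \<alpha> * (t - r) * (2 * (1 + \<theta>))" by simp
        then show "- 2 * \<alpha> * (t - r) * (1 + \<theta>) = - \<alpha> * p * (t - r) * \<theta>"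
          unfolding \<theta>(4)[symmetric] by (simp add: mult_ac)
        show "2 / p * (1 + \<theta>) = \<theta>" using \<theta>(4) p by (simp add: field_simps)
      qed
      show ?thesis
        unfolding powr_mult powr_powr exp_powr_real e by simp
    qed
    also have "\<dots> \<le> (moment p r / Y) powr \<theta>"
      using below \<theta> moment_nonneg[of t p] s by (intro powr_mono2) auto
    finally have m2: "moment 2 r powr (1 + \<theta>) \<le> moment p r powr \<theta> / Y powr \<theta>"
      by (simp add: powr_divide)
    have "a\<^sup>2 \<le> moment 2 r powr (1 + \<theta>) * moment p r powr (1 - \<theta>)"
      using moment_interpolation[OF r, of 2 p] p unfolding a_def \<theta>(2,3) by simp
    also have "\<dots> \<le> moment p r powr \<theta> / Y powr \<theta> * moment p r powr (1 - \<theta>)"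
      using m2 by (intro mult_right_mono) auto
    also have "\<dots> = moment p r / Y powr \<theta>"
      using pos by (simp flip: powr_add)
    finally have a2: "Y powr \<theta> * a\<^sup>2 \<le> moment p r"
      using Y by (simp add: le_divide_eq mult.commute)
    have "(2 * (p - 1) + p / (\<alpha> * \<beta>)) / (p - 2) * a\<^sup>2 \<le> moment p r"
      using mult_right_mono[OF barrier zero_le_power2] a2 order_trans by blast
    then have "\<alpha> * ((2 * (p - 1) + p / (\<alpha> * \<beta>)) * a\<^sup>2) \<le> \<alpha> * ((p - 2) * moment p r)"
      using p \<alpha> by (intro mult_left_mono) (auto simp: field_simps)
    moreover have "\<alpha> * ((2 * (p - 1) + p / (\<alpha> * \<beta>)) * a\<^sup>2)
        = (p - 1) * (2 * \<alpha> * a\<^sup>2 + a\<^sup>2 / (\<beta> * (p - 1) / p))"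
      using p \<alpha> \<beta> by (simp add: field_simps)
    ultimately have "\<alpha> * p * moment p r \<le> d"
      using d(2) by (simp add: algebra_simps)
    moreover have "(y has_real_derivative exp (\<alpha> * p * (t - r)) * (d - \<alpha> * p * moment p r)) (at r within {0..t})"
      unfolding y_def[abs_def]
      by (rule DERIV_cong, rule DERIV_mult[OF _ d(1)])
         (rule derivative_eq_intros refl | simp add: algebra_simps)+
    ultimately show "\<exists>d\<ge>0. (y has_real_derivative d) (at r within {0..t})"
      by (intro exI[of _ "exp (\<alpha> * p * (t - r)) * (d - \<alpha> * p * moment p r)"]) auto
  qed (rule s)
  then have "exp (- \<alpha> * p * (t - s)) * y s \<le> exp (- \<alpha> * p * (t - s)) * (Y * moment p t)"
    by (intro mult_left_mono) auto
  also have "exp (- \<alpha> * p * (t - s)) * y s = moment p s"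
    by (simp add: y_def flip: mult.assoc exp_add)
  finally show ?thesis by (simp only: Y_def c_def mult_ac)
qed

text \<open>With \<open>\<alpha> = 0\<close> and weight \<open>(p + 3) * t\<close>, the moment M of
  order p has derivative at least - c times the squared moment of order p/2. By interpolation with
  the contracted first moment, that square is at most \<open>F powr \<theta>\<close> times M to the
  power \<open>1 - \<theta>\<close>. Hence the power \<open>\<theta>\<close> of M grows at most
  linearly backwards in time, by the relative amount \<open>\<theta> * c * t = 1 / (p + 3)\<close>
  in total.\<close>

lemma moment_growth:
  assumes p: "p \<ge> 2" and t: "t > 0"
    and lam: "\<And>r. r \<in> {0..t} \<Longrightarrow> lam r \<ge> p / 4 * (A r + (p + 3) * t * B r)"
    and s: "s \<in> {0..t}"
  shows "moment p s powr (1 / p) \<le> 2 powr (1 / 4) * moment p t powr (1 / p)"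
proof -
  define \<theta> where "\<theta> = 1 / (p - 1)"
  define c where "c = (p - 1) / ((p + 3) * t)"
  define F where "F = moment p t"
  have \<theta>: "\<theta> > 0" "p / (p - 1) = 1 + \<theta>" "(p - 2 * 1) / (p - 1) = 1 - \<theta>" "1 / p * (1 + \<theta>) = \<theta>"
    using p by (auto simp: \<theta>_def field_simps)
  have c: "\<theta> * c * t = 1 / (p + 3)" "c \<ge> 0" using p t by (auto simp: \<theta>_def c_def)
  have F: "F \<ge> 0" using moment_nonneg[of t p] s by (simp add: F_def)
  \<comment> \<open>Subtracting the admissible linear growth leaves the constant level
    \<open>F powr \<theta>\<close>. Above this level the moment is positive, so its power can be
    differentiated.\<close>
  let ?z = "\<lambda>r. moment p r powr \<theta> - \<theta> * c * F powr \<theta> * (t - r)"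
  have "?z s \<le> F powr \<theta>"
  proof (rule stays_below[where a = 0 and b = t and y = ?z])
    show "continuous_on {0..t} ?z"
      using p \<theta> moment_nonneg
      by (intro continuous_intros continuous_on_powr' moment_continuous) auto
  next
    fix r assume r: "r \<in> {0..t}" and above: "F powr \<theta> < ?z r"
    have "0 \<le> \<theta> * c * F powr \<theta> * (t - r)" using \<theta> c r by simp
    then have "0 < moment p r powr \<theta>" using above powr_ge_zero[of F \<theta>] by linarith
    then have pos: "moment p r > 0" using moment_nonneg[OF r, of p] by (cases "moment p r = 0") auto
    have \<kappa>: "(p + 3) * t > 0" using p t by simp
    obtain d where d: "(moment p has_real_derivative d) (at r within {0..t})"
      "d \<ge> (p - 1) * - ((moment (p / 2) r)\<^sup>2 / ((p + 3) * t))"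
      using moment_derivative_ge[OF r p \<kappa>, of 0] lam[OF r] by auto
    have "(moment (p / 2) r)\<^sup>2 \<le> moment 1 r powr (1 + \<theta>) * moment p r powr (1 - \<theta>)"
      using moment_interpolation[OF r, of 1 p] p unfolding \<theta>(2,3) by simp
    also have "moment 1 r powr (1 + \<theta>) \<le> (F powr (1 / p)) powr (1 + \<theta>)"
      using moment_1_contraction[OF r] moment_le_moment_powr[of t 1 p] moment_nonneg[OF r, of 1] s p \<theta>
      by (intro powr_mono2) (auto simp: F_def)
    also have "\<dots> = F powr \<theta>" unfolding powr_powr \<theta>(4) ..
    finally have "c * (moment (p / 2) r)\<^sup>2 \<le> c * (F powr \<theta> * moment p r powr (1 - \<theta>))"
      using c by (intro mult_left_mono) (auto simp: mult_right_mono)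
    then have "- (c * F powr \<theta> * moment p r powr (1 - \<theta>)) \<le> d"
      using d(2) by (simp add: c_def)
    then have "moment p r powr (\<theta> - 1) * - (c * F powr \<theta> * moment p r powr (1 - \<theta>)) \<le> moment p r powr (\<theta> - 1) * d"
      by (intro mult_left_mono) auto
    moreover have "moment p r powr (\<theta> - 1) * - (c * F powr \<theta> * moment p r powr (1 - \<theta>)) = - (c * F powr \<theta>)"
    proof -
      have "moment p r powr (\<theta> - 1) * moment p r powr (1 - \<theta>) = 1"
        using pos by (simp flip: powr_add)
      then show ?thesis by (simp add: mult_ac)
    qed
    ultimately have "0 \<le> moment p r powr (\<theta> - 1) * d + c * F powr \<theta>" by linarith
    then have "0 \<le> \<theta> * (moment p r powr (\<theta> - 1) * d + c * F powr \<theta>)" using \<theta> by simp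
    moreover have "(?z has_real_derivative \<theta> * (moment p r powr (\<theta> - 1) * d + c * F powr \<theta>)) (at r within {0..t})"
    proof -
      have "((\<lambda>r. moment p r powr \<theta>) has_real_derivative (\<theta> * moment p r powr (\<theta> - 1)) * d) (at r within {0..t})"
        by (rule DERIV_chain2[OF has_real_derivative_powr[OF pos] d(1)])
      moreover have "((\<lambda>r. \<theta> * c * F powr \<theta> * (t - r)) has_real_derivative - (\<theta> * c * F powr \<theta>)) (at r within {0..t})"
        by (auto intro!: derivative_eq_intros)
      ultimately show ?thesis
        by (rule DERIV_cong[OF DERIV_diff]) (simp add: algebra_simps)
    qed
    ultimately show "\<exists>d\<ge>0. (?z has_real_derivative d) (at r within {0..t})" by blast
  qed (use s in \<open>auto simp: F_def\<close>)
  moreover have "\<theta> * c * F powr \<theta> * (t - s) \<le> \<theta> * c * F powr \<theta> * t"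
    using \<theta> c s by (intro mult_left_mono) auto
  ultimately have "moment p s powr \<theta> \<le> F powr \<theta> + \<theta> * c * F powr \<theta> * t" by linarith
  also have "\<dots> = F powr \<theta> * (1 + \<theta> * c * t)" by (simp add: algebra_simps)
  finally have "moment p s powr \<theta> \<le> F powr \<theta> * (1 + \<theta> * c * t)" .
  then have "(moment p s powr \<theta>) powr ((p - 1) / p) \<le> (F powr \<theta> * (1 + 1 / (p + 3))) powr ((p - 1) / p)"
    unfolding c using p by (intro powr_mono2) auto
  also have "\<dots> = F powr (1 / p) * (1 + 1 / (p + 3)) powr ((p - 1) / p)"
    using p by (simp add: powr_mult powr_powr \<theta>_def)
  also have "\<dots> \<le> F powr (1 / p) * 2 powr (1 / 4)"
  proof (rule mult_left_mono)
    \<comment> \<open>The tangent bound is 1 + (p - 1) / (p * (p + 3)), largest at p = 3 with value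
      10/9, whose fourth power is below 2.\<close>
    have "(1 + 1 / (p + 3)) powr ((p - 1) / p) \<le> 1 + (p - 1) / p * ((1 + 1 / (p + 3)) - 1)"
      using p by (intro powr_le_tangent_at_1) (auto intro: add_pos_pos)
    also have "\<dots> \<le> 10 / 9"
      using p zero_le_power2[of "p - 3"] by (simp add: field_simps power2_eq_square)
    also have "\<dots> = ((10 / 9) powr 4) powr (1 / 4)" unfolding powr_powr by simp
    also have "\<dots> \<le> 2 powr (1 / 4)"
      by (intro powr_mono2) (auto simp: power_divide)
    finally show "(1 + 1 / (p + 3)) powr ((p - 1) / p) \<le> 2 powr (1 / 4)" .
  qed simp
  finally show ?thesis
    using p by (simp add: powr_powr \<theta>_def F_def mult.commute)
qed

lemma moment_eq_0_iff:
  assumes s: "s \<in> {0..t}"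
  shows "moment p s = 0 \<longleftrightarrow> (\<forall>x\<in>T. w s x = 0)"
proof -
  have "m s x * \<bar>w s x\<bar> powr p \<ge> 0" if "x \<in> T" for x using m_pos[OF s that] by simp
  then have "moment p s = 0 \<longleftrightarrow> (\<forall>x\<in>T. m s x * \<bar>w s x\<bar> powr p = 0)"
    unfolding moment_def avg_def by (intro sum_nonneg_eq_0_iff finite_T)
  also have "\<dots> \<longleftrightarrow> (\<forall>x\<in>T. w s x = 0)" using m_pos[OF s] by force
  finally show ?thesis .
qed

lemma norm_2_decay:
  assumes p: "p \<ge> 2" and \<kappa>: "\<kappa> \<ge> 0" and \<alpha>: "\<alpha> \<ge> 0"
    and lam: "\<And>r. r \<in> {0..t} \<Longrightarrow> lam r \<ge> p / 4 * (A r + \<kappa> * B r + 2 * \<alpha> * C r)"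
    and mean_zero: "avg t (w t) = 0"
    and s: "s \<in> {0..t}"
  shows "moment 2 s powr (1 / 2) \<le> exp (- \<alpha> * (t - s)) * moment 2 t powr (1 / 2)"
proof -
  have "moment 2 s powr (1 / 2) \<le> (exp (- 2 * \<alpha> * (t - s)) * moment 2 t) powr (1 / 2)"
    using moment_2_decay[OF assms] moment_nonneg[OF s] by (intro powr_mono2) auto
  also have "\<dots> = exp (- 2 * \<alpha> * (t - s) * (1 / 2)) * moment 2 t powr (1 / 2)"
    unfolding powr_mult exp_powr_real ..
  finally show ?thesis by simp
qed

lemma norm_decay:
  assumes p: "p = 2 \<or> p \<ge> 4" and \<alpha>: "\<alpha> > 0" and \<beta>: "\<beta> > 0"
    and lam: "\<And>r. r \<in> {0..t} \<Longrightarrow> lam r \<ge> p / 4 * (A r + \<beta> * (p - 1) / p * B r + 2 * \<alpha> * C r)"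
    and mean_zero: "avg t (w t) = 0"
    and s: "s \<in> {0..t}"
  shows "moment p s powr (1 / p)
    \<le> exp (- \<alpha> * (t - s)) * sqrt (2 + 1 / (\<alpha> * \<beta>)) * moment p t powr (1 / p)"
  using p
proof
  assume p2: "p = 2"
  have "moment 2 s powr (1 / 2) \<le> exp (- \<alpha> * (t - s)) * moment 2 t powr (1 / 2)"
    using p2 \<alpha> \<beta> by (intro norm_2_decay[OF _ _ _ lam mean_zero s]) auto
  also have "\<dots> \<le> exp (- \<alpha> * (t - s)) * sqrt (2 + 1 / (\<alpha> * \<beta>)) * moment 2 t powr (1 / 2)"
    using \<alpha> \<beta> by (intro mult_right_mono) (auto intro!: add_increasing2)
  finally show ?thesis by (simp add: p2)
next
  assume p4: "p \<ge> 4"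
  have "moment p s powr (1 / p)
      \<le> ((2 + 1 / (\<alpha> * \<beta>)) powr (p / 2) * exp (- \<alpha> * p * (t - s)) * moment p t) powr (1 / p)"
    using moment_decay[OF p4 assms(2-)] moment_nonneg[OF s] p4 by (intro powr_mono2) auto
  also have "\<dots> = (2 + 1 / (\<alpha> * \<beta>)) powr (p / 2 * (1 / p)) * exp (- \<alpha> * p * (t - s) * (1 / p)) * moment p t powr (1 / p)"
    unfolding powr_mult exp_powr_real powr_powr ..
  also have "p / 2 * (1 / p) = 1 / 2" using p4 by simp
  also have "- \<alpha> * p * (t - s) * (1 / p) = - \<alpha> * (t - s)" using p4 by simp
  also have "(2 + 1 / (\<alpha> * \<beta>)) powr (1 / 2) = sqrt (2 + 1 / (\<alpha> * \<beta>))"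
    using \<alpha> \<beta> by (intro powr_half_sqrt) auto
  finally show ?thesis by (simp only: mult_ac)
qed

text \<open>Serves the convention that infinity times 0 is 0: with an infinite constant, the bound
  has content exactly when the terminal norm vanishes. The solution is then zero on \<open>T\<close>
  at time \<open>t\<close>, and the decay of the second moment carries this back.\<close>

lemma moment_eq_0_backward:
  assumes p: "p \<ge> 2" and \<kappa>: "\<kappa> \<ge> 0" and \<alpha>: "\<alpha> \<ge> 0"
    and lam: "\<And>r. r \<in> {0..t} \<Longrightarrow> lam r \<ge> p / 4 * (A r + \<kappa> * B r + 2 * \<alpha> * C r)"
    and mean_zero: "avg t (w t) = 0"
    and s: "s \<in> {0..t}" and zero: "moment p t = 0"
  shows "moment p s = 0"
proof -
  have "moment 2 t = 0" using zero s by (simp add: moment_eq_0_iff)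
  then have "moment 2 s \<le> 0" using moment_2_decay[OF assms(1-6)] by simp
  then have "moment 2 s = 0" using moment_nonneg[OF s, of 2] by simp
  then show ?thesis by (simp add: moment_eq_0_iff[OF s])
qed

end

section \<open>Conditioning on an invariant set\<close>

context feynman_kac_setting
begin

definition dU :: "real \<Rightarrow> 'a \<Rightarrow> real" where
  "dU t x = vector_derivative (\<lambda>s. U s x) (at t within {0..})"

text \<open>Makes one-sided derivatives unique, so that the \<open>vector_derivative\<close> in the
  definition of \<open>H\<close> can be evaluated.\<close>

lemma at_within_Ici_neq_bot: "(s::real) \<ge> 0 \<Longrightarrow> at s within {0..} \<noteq> bot"
proof
  assume s: "s \<ge> 0" and bot: "at s within {0..} = bot"
  have "at_right s \<le> at s within {0..}" using s by (intro at_le) auto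
  then show False using bot trivial_limit_at_right_real[of s] by (simp add: bot_unique)
qed

lemma U_has_derivative:
  assumes "s \<ge> 0"
  shows "((\<lambda>s. U s x) has_real_derivative dU s x) (at s within {0..})"
proof -
  have "(\<lambda>s. U s x) differentiable (at s within {0..})"
    using U_differentiable[of x] assms by (auto simp: differentiable_on_def)
  then show ?thesis
    unfolding dU_def has_real_derivative_iff_has_vector_derivative
    by (rule vector_derivative_works[THEN iffD1])
qed

text \<open>Source of the differentiability of \<open>Z\<close>: total mass one makes it a finite
  sum of exponentials.\<close>

lemma Z_eq:
  assumes "s \<ge> 0"
  shows "Z s = (\<Sum>x\<in>UNIV. exp (- U s x) * pmf (\<mu> 0) x)" and "Z s > 0"
proof -
  obtain x :: 'a where True by simp
  have "0 < exp (- U s x) * pmf (\<mu> 0) x / Z s"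
    using pos[OF assms, of x] gibbs[OF assms, of x] by simp
  moreover have "0 < exp (- U s x) * pmf (\<mu> 0) x"
    using pos[of 0 x] by simp
  ultimately show Z: "Z s > 0" by (simp only: zero_less_divide_iff) auto
  have "1 = (\<Sum>x\<in>UNIV. pmf (\<mu> s) x)" by (simp add: sum_pmf_eq_1)
  also have "\<dots> = (\<Sum>x\<in>UNIV. exp (- U s x) * pmf (\<mu> 0) x) / Z s"
    by (simp add: gibbs[OF assms] sum_divide_distrib)
  finally show "Z s = (\<Sum>x\<in>UNIV. exp (- U s x) * pmf (\<mu> 0) x)" using Z by simp
qed

lemma pmf_has_derivative:
  assumes s: "s \<ge> 0"
  shows "((\<lambda>s. pmf (\<mu> s) x) has_real_derivative
    - (dU s x - (\<Sum>y\<in>UNIV. pmf (\<mu> s) y * dU s y)) * pmf (\<mu> s) x) (at s within {0..})"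
proof (rule has_field_derivative_transform_within[OF _ zero_less_one])
  let ?e = "\<lambda>s x. exp (- U s x) * pmf (\<mu> 0) x"
  have e: "((\<lambda>s. ?e s x) has_real_derivative - dU s x * ?e s x) (at s within {0..})" for x
    by (auto intro!: derivative_eq_intros U_has_derivative s)
  have Zs: "Z s = (\<Sum>x\<in>UNIV. ?e s x)" "(\<Sum>x\<in>UNIV. ?e s x) \<noteq> 0"
    using Z_eq[OF s] by auto
  have "((\<lambda>s. ?e s x / (\<Sum>x\<in>UNIV. ?e s x)) has_real_derivative
      ((- dU s x * ?e s x) * (\<Sum>x\<in>UNIV. ?e s x) - ?e s x * (\<Sum>x\<in>UNIV. - dU s x * ?e s x))
        / ((\<Sum>x\<in>UNIV. ?e s x) * (\<Sum>x\<in>UNIV. ?e s x))) (at s within {0..})"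
    by (intro DERIV_divide e DERIV_sum Zs(2))
  also have "((- dU s x * ?e s x) * (\<Sum>x\<in>UNIV. ?e s x) - ?e s x * (\<Sum>x\<in>UNIV. - dU s x * ?e s x))
        / ((\<Sum>x\<in>UNIV. ?e s x) * (\<Sum>x\<in>UNIV. ?e s x))
      = - (dU s x - (\<Sum>y\<in>UNIV. - (- dU s y * ?e s y)) / Z s) * (?e s x / Z s)"
    using Zs unfolding Zs(1)[symmetric] sum_negf by (simp add: field_simps)
  also have "(\<Sum>y\<in>UNIV. - (- dU s y * ?e s y)) / Z s = (\<Sum>y\<in>UNIV. pmf (\<mu> s) y * dU s y)"
    by (simp add: gibbs[OF s] sum_divide_distrib mult_ac)
  also have "?e s x / Z s = pmf (\<mu> s) x" by (simp add: gibbs[OF s])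
  finally show "((\<lambda>s. ?e s x / (\<Sum>x\<in>UNIV. ?e s x)) has_real_derivative
      - (dU s x - (\<Sum>y\<in>UNIV. pmf (\<mu> s) y * dU s y)) * pmf (\<mu> s) x) (at s within {0..})" .
next
  fix r :: real assume "r \<in> {0..}"
  then show "exp (- U r x) * pmf (\<mu> 0) x / (\<Sum>x\<in>UNIV. exp (- U r x) * pmf (\<mu> 0) x) = pmf (\<mu> r) x"
    using gibbs[of r x] Z_eq[of r] by simp
qed (use s in auto)

lemma H_eq:
  assumes s: "s \<ge> 0"
  shows "H \<mu> s x = dU s x - (\<Sum>y\<in>UNIV. pmf (\<mu> s) y * dU s y)"
proof -
  let ?h = "dU s x - (\<Sum>y\<in>UNIV. pmf (\<mu> s) y * dU s y)"
  have "((\<lambda>s. ln (pmf (\<mu> s) x)) has_real_derivative (1 / pmf (\<mu> s) x) * (- ?h * pmf (\<mu> s) x)) (at s within {0..})"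
    by (rule DERIV_chain2[OF DERIV_ln_divide pmf_has_derivative]) (use s pos in auto)
  then have "((\<lambda>s. ln (pmf (\<mu> s) x)) has_vector_derivative - ?h) (at s within {0..})"
    using pos[OF s, of x] by (simp add: has_real_derivative_iff_has_vector_derivative)
  then show ?thesis
    unfolding H_def using vector_derivative_within[OF at_within_Ici_neq_bot[OF s]] by fastforce
qed

lemma H_continuous: "continuous_on {0..} (\<lambda>s. H \<mu> s x)"
proof -
  have "continuous_on {0..} (\<lambda>s. pmf (\<mu> s) y)" for y
    by (rule DERIV_continuous_on) (use pmf_has_derivative in auto)
  moreover have "continuous_on {0..} (\<lambda>s. dU s y)" for y
    unfolding dU_def by (rule U_deriv_continuous)
  ultimately have "continuous_on {0..} (\<lambda>s. dU s x - (\<Sum>y\<in>UNIV. pmf (\<mu> s) y * dU s y))"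
    by (intro continuous_intros)
  then show ?thesis by (rule continuous_on_eq) (simp add: H_eq)
qed

lemma pmf_derivative_H:
  assumes "s \<ge> 0"
  shows "((\<lambda>s. pmf (\<mu> s) x) has_real_derivative - H \<mu> s x * pmf (\<mu> s) x) (at s within {0..})"
  using pmf_has_derivative[OF assms] by (simp add: H_eq[OF assms])

end

section \<open>Conditional measures and their evolution\<close>

lemma expectation_cond_pmf:
  fixes p :: "'a::finite pmf"
  assumes "set_pmf p \<inter> T \<noteq> {}"
  shows "measure_pmf.expectation (cond_pmf p T) f = (\<Sum>x\<in>T. pmf (cond_pmf p T) x * f x)"
proof -
  have "measure_pmf.expectation (cond_pmf p T) f = (\<Sum>x\<in>T. f x * pmf (cond_pmf p T) x)"
    by (rule integral_measure_pmf_real) (use assms in \<open>auto simp: set_cond_pmf\<close>)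
  then show ?thesis by (simp add: mult.commute)
qed

locale feynman_kac_invariant_set = feynman_kac_setting +
  fixes T :: "'a set"
  assumes T_nonempty: "T \<noteq> {}"
    and T_invariant: "t \<ge> 0 \<Longrightarrow> x \<in> T \<Longrightarrow> y \<notin> T \<Longrightarrow> L t x y = 0"
begin

definition mass :: "real \<Rightarrow> real" where
  "mass s = measure_pmf.prob (\<mu> s) T"

definition cond :: "real \<Rightarrow> 'a \<Rightarrow> real" where
  "cond s x = pmf (cond_pmf (\<mu> s) T) x"

lemma meets_T:
  assumes "s \<ge> 0"
  shows "set_pmf (\<mu> s) \<inter> T \<noteq> {}"
proof -
  have "x \<in> set_pmf (\<mu> s)" for x using pos[OF assms, of x] by (simp add: set_pmf_iff)
  then show ?thesis using T_nonempty by auto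
qed

lemma mass_eq: "mass s = (\<Sum>x\<in>T. pmf (\<mu> s) x)"
  by (simp add: mass_def measure_measure_pmf_finite)

lemma mass_pos: "s \<ge> 0 \<Longrightarrow> mass s > 0"
  unfolding mass_eq using T_nonempty pos by (intro sum_pos) auto

lemma cond_eq: "s \<ge> 0 \<Longrightarrow> x \<in> T \<Longrightarrow> cond s x = pmf (\<mu> s) x / mass s"
  by (simp add: cond_def mass_def pmf_cond meets_T)

lemma expectation_cond:
  "s \<ge> 0 \<Longrightarrow> measure_pmf.expectation (cond_pmf (\<mu> s) T) f = (\<Sum>x\<in>T. cond s x * f x)"
  unfolding cond_def by (rule expectation_cond_pmf[OF meets_T])

lemma Lp_norm_cond:
  assumes "s \<ge> 0"
  shows "Lp_norm p (cond_pmf (\<mu> s) T) f = (\<Sum>x\<in>T. cond s x * \<bar>f x\<bar> powr p) powr (1 / p)"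
proof -
  have "(\<Sum>x\<in>UNIV. \<bar>f x\<bar> powr p * pmf (cond_pmf (\<mu> s) T) x) = (\<Sum>x\<in>T. cond s x * \<bar>f x\<bar> powr p)"
    using meets_T[OF assms]
    by (intro sum.mono_neutral_cong_right) (auto simp: cond_def pmf_cond mult.commute)
  then show ?thesis by (simp add: Lp_norm_def)
qed

text \<open>Invariance closes the backward equation on \<open>T\<close>: values outside never
  enter.\<close>

lemma generator_eq:
  assumes "s \<ge> 0" "x \<in> T"
  shows "generator (L s) f x = (\<Sum>y\<in>T. L s x y * f y)"
  unfolding generator_def using T_invariant assms
  by (intro sum.mono_neutral_right) auto

lemma cond_sum: "s \<ge> 0 \<Longrightarrow> (\<Sum>x\<in>T. cond s x) = 1"
  using expectation_cond[of s "\<lambda>_. 1"] by simp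

lemma cond_H_eq: "s \<ge> 0 \<Longrightarrow> cond_H \<mu> T s x = H \<mu> s x - (\<Sum>y\<in>T. cond s y * H \<mu> s y)"
  by (simp add: cond_H_def expectation_cond)

lemma pmf_deriv:
  assumes "s \<in> {0..t}"
  shows "((\<lambda>s. pmf (\<mu> s) x) has_real_derivative - H \<mu> s x * pmf (\<mu> s) x) (at s within {0..t})"
  by (rule has_field_derivative_subset[OF pmf_derivative_H]) (use assms in auto)

text \<open>The logarithmic derivative of the mass is minus the conditional mean of
  \<open>H\<close>, exactly the difference between \<open>cond_H\<close> and
  \<open>H\<close>.\<close>

lemma mass_deriv:
  assumes s: "s \<in> {0..t}"
  shows "(mass has_real_derivative - (\<Sum>y\<in>T. cond s y * H \<mu> s y) * mass s) (at s within {0..t})"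
proof -
  have "(mass has_real_derivative (\<Sum>x\<in>T. - H \<mu> s x * pmf (\<mu> s) x)) (at s within {0..t})"
    unfolding mass_eq[abs_def] by (intro DERIV_sum pmf_deriv s)
  also have "(\<Sum>x\<in>T. - H \<mu> s x * pmf (\<mu> s) x) = (\<Sum>y\<in>T. - (cond s y * H \<mu> s y * mass s))"
    using s mass_pos[of s] by (intro sum.cong refl) (simp add: cond_eq)
  also have "\<dots> = - (\<Sum>y\<in>T. cond s y * H \<mu> s y) * mass s"
    by (simp add: sum_distrib_right sum_negf)
  finally show ?thesis .
qed

text \<open>Multiplying the solution by \<open>mass s / mass t\<close> replaces \<open>H\<close> by its centred version in the
  backward equation, which accounts for the ratio of masses in the estimates.\<close>

lemma fk_flow_normalized:
  assumes t: "t \<ge> 0" and u: "solves_backward \<mu> L lam t f u"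
  shows "fk_flow T t cond (cond_H \<mu> T) (\<lambda>s x. u s x * (mass s / mass t)) L lam"
proof
  show "finite T" by simp
  show "cond s x > 0" if "s \<in> {0..t}" "x \<in> T" for s x
    using that pos[of s] mass_pos[of s] by (simp add: cond_eq)
  show "(\<Sum>x\<in>T. cond s x) = 1" if "s \<in> {0..t}" for s
    using that cond_sum by simp
  show "(\<Sum>x\<in>T. cond s x * cond_H \<mu> T s x) = 0" if "s \<in> {0..t}" for s
    using that cond_sum[of s]
    by (simp add: cond_H_eq right_diff_distrib sum_subtractf flip: sum_distrib_right)
  have cond_deriv: "((\<lambda>s. cond s x) has_real_derivative - cond_H \<mu> T s x * cond s x) (at s within {0..t})"
    if s: "s \<in> {0..t}" and x: "x \<in> T" for s x
  proof (rule has_field_derivative_transform_within[OF _ zero_less_one])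
    let ?c = "\<Sum>y\<in>T. cond s y * H \<mu> s y"
    have M: "mass s \<noteq> 0" using mass_pos[of s] s by simp
    have "((\<lambda>s. pmf (\<mu> s) x / mass s) has_real_derivative
        ((- H \<mu> s x * pmf (\<mu> s) x) * mass s - pmf (\<mu> s) x * (- ?c * mass s)) / (mass s * mass s)) (at s within {0..t})"
      by (intro DERIV_divide pmf_deriv mass_deriv s M)
    also have "((- H \<mu> s x * pmf (\<mu> s) x) * mass s - pmf (\<mu> s) x * (- ?c * mass s)) / (mass s * mass s)
        = - cond_H \<mu> T s x * cond s x"
      using M s x by (simp add: cond_H_eq cond_eq[of s x]) (simp add: field_simps)
    finally show "((\<lambda>s. pmf (\<mu> s) x / mass s) has_real_derivative - cond_H \<mu> T s x * cond s x) (at s within {0..t})" .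
  qed (use s x in \<open>auto simp: cond_eq\<close>)
  show "((\<lambda>s. cond s x) has_real_derivative - cond_H \<mu> T s x * cond s x) (at s within {0..t})"
    if "s \<in> {0..t}" "x \<in> T" for s x
    by (rule cond_deriv[OF that])
  show "\<exists>K. \<forall>s\<in>{0..t}. \<forall>x\<in>T. \<bar>cond_H \<mu> T s x\<bar> \<le> K"
  proof -
    have "\<exists>K. \<forall>s\<in>{0..t}. \<bar>cond_H \<mu> T s x\<bar> \<le> K" for x
    proof -
      have H: "continuous_on {0..t} (\<lambda>s. H \<mu> s y)" for y
        by (rule continuous_on_subset[OF H_continuous]) auto
      have cond: "continuous_on {0..t} (\<lambda>s. cond s y)" if "y \<in> T" for y
        by (rule DERIV_continuous_on) (use cond_deriv that in auto)
      have "continuous_on {0..t} (\<lambda>s. H \<mu> s x - (\<Sum>y\<in>T. cond s y * H \<mu> s y))"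
        by (intro continuous_on_diff continuous_on_sum continuous_on_mult H cond)
      then have "compact ((\<lambda>s. H \<mu> s x - (\<Sum>y\<in>T. cond s y * H \<mu> s y)) ` {0..t})"
        by (intro compact_continuous_image compact_Icc)
      then obtain K where "\<forall>s\<in>{0..t}. \<bar>H \<mu> s x - (\<Sum>y\<in>T. cond s y * H \<mu> s y)\<bar> \<le> K"
        by (auto dest!: compact_imp_bounded simp: bounded_iff)
      then show ?thesis by (auto simp: cond_H_eq)
    qed
    then obtain K where K: "\<And>x. \<forall>s\<in>{0..t}. \<bar>cond_H \<mu> T s x\<bar> \<le> K x" by metis
    have "\<bar>cond_H \<mu> T s x\<bar> \<le> Max (range K)" if "s \<in> {0..t}" for s x
      using K[of x] that by (intro order_trans[OF _ Max_ge[of "range K" "K x"]]) auto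
    then show ?thesis by blast
  qed
  have Q: "Q_matrix (L s)" if "s \<in> {0..t}" for s using that L_Q_matrix by simp
  show "L s x y \<ge> 0" if "s \<in> {0..t}" "x \<noteq> y" for s x y
    using Q[OF that(1)] that(2) by (simp add: Q_matrix_def)
  show "(\<Sum>y\<in>T. L s x y) = 0" if "s \<in> {0..t}" "x \<in> T" for s x
    using generator_eq[of s x "\<lambda>_. 1"] Q[OF that(1)] that by (simp add: Q_matrix_def generator_def)
  show "cond s x * L s x y = cond s y * L s y x" if "s \<in> {0..t}" "x \<in> T" "y \<in> T" for s x y
    using detailed_balance[of s x y] that by (simp add: cond_eq)
  show "lam s \<ge> 0" if "s \<in> {0..t}" for s
    using lam_pos[of s] that by simp
  show "((\<lambda>s. u s x * (mass s / mass t)) has_real_derivative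
      - (lam s * (\<Sum>y\<in>T. L s x y * (u s y * (mass s / mass t))))
        + cond_H \<mu> T s x * (u s x * (mass s / mass t))) (at s within {0..t})"
    if s: "s \<in> {0..t}" and x: "x \<in> T" for s x
  proof -
    let ?c = "\<Sum>y\<in>T. cond s y * H \<mu> s y" and ?R = "\<Sum>y\<in>T. L s x y * u s y"
    have "((\<lambda>r. u r x) has_real_derivative - (lam s * generator (L s) (u s) x - H \<mu> s x * u s x)) (at s within {0..t})"
      using u s unfolding solves_backward_def by blast
    then have "((\<lambda>r. u r x) has_real_derivative - (lam s * ?R - H \<mu> s x * u s x)) (at s within {0..t})"
      using s x by (simp only: generator_eq atLeastAtMost_iff)
    then have "((\<lambda>s. u s x * (mass s / mass t)) has_real_derivative
        - (lam s * ?R - H \<mu> s x * u s x) * (mass s / mass t) + (- ?c * mass s / mass t) * u s x) (at s within {0..t})"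
      by (intro DERIV_mult DERIV_cdivide mass_deriv s)
    moreover have "(\<Sum>y\<in>T. L s x y * (u s y * (mass s / mass t))) = ?R * (mass s / mass t)"
      by (simp only: sum_distrib_right mult.assoc)
    ultimately show ?thesis
      using s by (simp add: cond_H_eq algebra_simps diff_divide_distrib)
  qed
qed

lemma fk_flow_inequalities_normalized:
  assumes t: "t \<ge> 0" and u: "solves_backward \<mu> L lam t f u"
    and C: "\<And>t f. t \<ge> 0 \<Longrightarrow>
      measure_pmf.variance (cond_pmf (\<mu> t) T) f \<le> C t * cond_form \<mu> L T t f"
    and A: "\<And>t f. t \<ge> 0 \<Longrightarrow>
      - measure_pmf.expectation (cond_pmf (\<mu> t) T)
          (\<lambda>x. cond_H \<mu> T t x * (f x - measure_pmf.expectation (cond_pmf (\<mu> t) T) f)\<^sup>2)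
        \<le> A t * cond_form \<mu> L T t f"
    and B: "\<And>t f. t \<ge> 0 \<Longrightarrow>
      \<bar>measure_pmf.expectation (cond_pmf (\<mu> t) T) (\<lambda>x. cond_H \<mu> T t x * f x)\<bar>\<^sup>2
        \<le> B t * cond_form \<mu> L T t f"
  shows "fk_flow_inequalities T t cond (cond_H \<mu> T) (\<lambda>s x. u s x * (mass s / mass t)) L lam A B C"
proof -
  interpret fk_flow T t cond "cond_H \<mu> T" "\<lambda>s x. u s x * (mass s / mass t)" L lam
    by (rule fk_flow_normalized[OF t u])
  have avg: "measure_pmf.expectation (cond_pmf (\<mu> s) T) g = avg s g" if "s \<ge> 0" for s g
    using expectation_cond[OF that] by (simp add: avg_def)
  have form: "cond_form \<mu> L T s g = form s g g" if "s \<ge> 0" for s g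
    using that by (simp add: cond_form_def form_def avg) (simp add: avg_def generator_eq)
  show ?thesis
  proof
    fix s g assume "s \<in> {0..t}"
    then have s: "s \<ge> 0" by simp
    show "avg s (\<lambda>x. (g x - avg s g)\<^sup>2) \<le> C s * form s g g"
      using C[OF s, of g] by (simp only: avg[OF s] form[OF s])
    show "- avg s (\<lambda>x. cond_H \<mu> T s x * (g x - avg s g)\<^sup>2) \<le> A s * form s g g"
      using A[OF s, of g] by (simp only: avg[OF s] form[OF s])
    show "(avg s (\<lambda>x. cond_H \<mu> T s x * g x))\<^sup>2 \<le> B s * form s g g"
      using B[OF s, of g] by (simp only: avg[OF s] form[OF s] power2_abs)
  qed
qed

lemma Lp_norm_eq_moment:
  assumes "s \<ge> 0" "t \<ge> 0" "p > 0" and u: "solves_backward \<mu> L lam t f u"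
  shows "Lp_norm p (cond_pmf (\<mu> s) T) (u s) =
    mass t / mass s * fk_flow.moment T cond (\<lambda>s x. u s x * (mass s / mass t)) p s powr (1 / p)"
proof -
  interpret fk_flow T t cond "cond_H \<mu> T" "\<lambda>s x. u s x * (mass s / mass t)" L lam
    by (rule fk_flow_normalized[OF assms(2) u])
  have M: "mass s > 0" "mass t > 0" using mass_pos assms by auto
  have "(\<Sum>x\<in>T. cond s x * \<bar>u s x * (mass s / mass t)\<bar> powr p)
      = (mass s / mass t) powr p * (\<Sum>x\<in>T. cond s x * \<bar>u s x\<bar> powr p)"
  proof -
    have "\<bar>a * (mass s / mass t)\<bar> powr p = (mass s / mass t) powr p * \<bar>a\<bar> powr p" for a
      using M by (simp only: abs_mult powr_mult) (simp add: mult.commute)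
    then show ?thesis by (simp add: sum_distrib_left mult.left_commute)
  qed
  also have "\<dots> powr (1 / p) = mass s / mass t * (\<Sum>x\<in>T. cond s x * \<bar>u s x\<bar> powr p) powr (1 / p)"
    unfolding powr_mult powr_powr using M assms by simp
  finally show ?thesis
    unfolding Lp_norm_cond[OF assms(1)] moment_def avg_def using M by simp
qed

end

theorem corollary10:
  fixes \<mu> :: "real \<Rightarrow> ('a::finite) pmf"
    and Z :: "real \<Rightarrow> real"
    and U :: "real \<Rightarrow> 'a \<Rightarrow> real"
    and L :: "real \<Rightarrow> 'a \<Rightarrow> 'a \<Rightarrow> real"
    and lam :: "real \<Rightarrow> real"
    and q :: "real \<Rightarrow> real \<Rightarrow> ('a \<Rightarrow> real) \<Rightarrow> 'a \<Rightarrow> real"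
    and T :: "'a set"
    and A B C :: "real \<Rightarrow> real"
    and t \<alpha> \<beta> :: real
  assumes setting: "feynman_kac_setting \<mu> Z U L lam"
    and q: "\<And>t f. t \<ge> 0 \<Longrightarrow> solves_backward \<mu> L lam t f (\<lambda>s. q s t f)"
    and T_nonempty: "T \<noteq> {}"
    and T_invariant: "\<And>t x y. t \<ge> 0 \<Longrightarrow> x \<in> T \<Longrightarrow> y \<notin> T \<Longrightarrow> L t x y = 0"
    and C: "\<And>t f. t \<ge> 0 \<Longrightarrow>
      measure_pmf.variance (cond_pmf (\<mu> t) T) f \<le> C t * cond_form \<mu> L T t f"
    and A: "\<And>t f. t \<ge> 0 \<Longrightarrow>
      - measure_pmf.expectation (cond_pmf (\<mu> t) T)
          (\<lambda>x. cond_H \<mu> T t x * (f x - measure_pmf.expectation (cond_pmf (\<mu> t) T) f)\<^sup>2)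
        \<le> A t * cond_form \<mu> L T t f"
    and B: "\<And>t f. t \<ge> 0 \<Longrightarrow>
      \<bar>measure_pmf.expectation (cond_pmf (\<mu> t) T) (\<lambda>x. cond_H \<mu> T t x * f x)\<bar>\<^sup>2
        \<le> B t * cond_form \<mu> L T t f"
    and t: "t \<ge> 0" and \<alpha>: "\<alpha> \<ge> 0" and \<beta>: "\<beta> \<ge> 0"
  shows
    "(\<forall>p\<ge>2. (\<forall>s\<in>{0..t}. lam s \<ge> p / 4 * A s + p * (p + 3) / 4 * t * B s) \<longrightarrow>
        (\<forall>f. \<forall>s\<in>{0..t}.
          Lp_norm p (cond_pmf (\<mu> s) T) (q s t f)
            \<le> 2 powr (1 / 4) * (measure_pmf.prob (\<mu> t) T / measure_pmf.prob (\<mu> s) T)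
                * Lp_norm p (cond_pmf (\<mu> t) T) f)) \<and>
     ((\<forall>s\<in>{0..t}. lam s \<ge> 1 / 2 * A s + \<alpha> * C s) \<longrightarrow>
        (\<forall>s\<in>{0..t}. \<forall>f. measure_pmf.expectation (cond_pmf (\<mu> t) T) f = 0 \<longrightarrow>
          Lp_norm 2 (cond_pmf (\<mu> s) T) (q s t f)
            \<le> exp (- \<alpha> * (t - s)) * (measure_pmf.prob (\<mu> t) T / measure_pmf.prob (\<mu> s) T)
                * Lp_norm 2 (cond_pmf (\<mu> t) T) f)) \<and>
     (\<forall>(n::nat) p. n \<ge> 1 \<longrightarrow> p = 2 ^ n \<longrightarrow>
        (\<forall>s\<in>{0..t}. lam s \<ge> p / 4 * A s + \<beta> * ((p - 1) / 4) * B s + \<alpha> * (p / 2) * C s) \<longrightarrow>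
        (\<forall>s\<in>{0..t}. \<forall>f. measure_pmf.expectation (cond_pmf (\<mu> t) T) f = 0 \<longrightarrow>
          ereal (Lp_norm p (cond_pmf (\<mu> s) T) (q s t f))
            \<le> ereal (exp (- \<alpha> * (t - s))) * amplification \<alpha> \<beta>
                * ereal (measure_pmf.prob (\<mu> t) T / measure_pmf.prob (\<mu> s) T)
                * ereal (Lp_norm p (cond_pmf (\<mu> t) T) f)))"
proof -
  interpret feynman_kac_invariant_set \<mu> Z U L lam T
    by (intro feynman_kac_invariant_set.intro setting feynman_kac_invariant_set_axioms.intro
        T_nonempty T_invariant)
  let ?w = "\<lambda>f s x. q s t f x * (mass s / mass t)"
  have flow: "fk_flow_inequalities T t cond (cond_H \<mu> T) (?w f) L lam A B C" for f
    by (rule fk_flow_inequalities_normalized[OF t q[OF t] C A B])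
  define N where "N p f s = fk_flow.moment T cond (?w f) p s powr (1 / p)" for p f s
  have norm: "Lp_norm p (cond_pmf (\<mu> s) T) (q s t f) = mass t / mass s * N p f s"
    if "s \<in> {0..t}" "p > 0" for p f s
    using Lp_norm_eq_moment[OF _ t that(2) q[OF t, of f], of s] that by (simp add: N_def)
  have q_end: "q t t f = f" for f
    using q[OF t, of f] by (simp add: solves_backward_def)
  have norm_end: "Lp_norm p (cond_pmf (\<mu> t) T) f = N p f t" if "p > 0" for p f
    using norm[of t p f] mass_pos[OF t] t that by (simp add: q_end)
  have ratio: "0 \<le> mass t / mass s" if "s \<in> {0..t}" for s
    using mass_pos[OF t] mass_pos[of s] that by simp
  have mean: "fk_flow.avg T cond t (?w f t) = 0"
    if "measure_pmf.expectation (cond_pmf (\<mu> t) T) f = 0" for f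
    using that mass_pos[OF t] expectation_cond[OF t, of f]
      fk_flow.avg_def[OF fk_flow_inequalities.axioms(1)[OF flow]] by (simp add: q_end)
  note scale = mult_left_mono[OF _ ratio]

  have "Lp_norm p (cond_pmf (\<mu> s) T) (q s t f)
      \<le> 2 powr (1 / 4) * (mass t / mass s) * Lp_norm p (cond_pmf (\<mu> t) T) f"
    if p: "p \<ge> 2" and lam: "\<forall>s\<in>{0..t}. lam s \<ge> p / 4 * A s + p * (p + 3) / 4 * t * B s"
      and s: "s \<in> {0..t}" for p f s
  proof -
    interpret fk_flow_inequalities T t cond "cond_H \<mu> T" "?w f" L lam A B C by (rule flow)
    have "N p f s \<le> 2 powr (1 / 4) * N p f t"
    \<comment> \<open>The weight \<open>(p + 3) * t\<close> degenerates at \<open>t = 0\<close>,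
      where the claim is that the constant is at least 1.\<close>
    proof (cases "t > 0")
      case True
      have "lam r \<ge> p / 4 * (A r + (p + 3) * t * B r)" if "r \<in> {0..t}" for r
        using bspec[OF lam that] by (simp add: field_simps)
      then show ?thesis unfolding N_def by (intro moment_growth p True s)
    next
      case False
      then have "s = t" using s t by simp
      moreover have "(1::real) * N p f t \<le> 2 powr (1 / 4) * N p f t"
        by (intro mult_right_mono ge_one_powr_ge_zero) (auto simp: N_def)
      ultimately show ?thesis by simp
    qed
    from scale[OF this s] show ?thesis
      using p by (simp add: norm[OF s] norm_end mult_ac)
  qed
  moreover have "Lp_norm 2 (cond_pmf (\<mu> s) T) (q s t f)
      \<le> exp (- \<alpha> * (t - s)) * (mass t / mass s) * Lp_norm 2 (cond_pmf (\<mu> t) T) f"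
    if lam: "\<forall>s\<in>{0..t}. lam s \<ge> 1 / 2 * A s + \<alpha> * C s"
      and s: "s \<in> {0..t}" and f: "measure_pmf.expectation (cond_pmf (\<mu> t) T) f = 0" for s f
  proof -
    interpret fk_flow_inequalities T t cond "cond_H \<mu> T" "?w f" L lam A B C by (rule flow)
    \<comment> \<open>Part (ii) is the decay estimate with \<open>p = 2\<close> and weight 0 on
      \<open>B\<close>.\<close>
    have "lam r \<ge> 2 / 4 * (A r + 0 * B r + 2 * \<alpha> * C r)" if "r \<in> {0..t}" for r
      using bspec[OF lam that] by (simp add: field_simps)
    then have "N 2 f s \<le> exp (- \<alpha> * (t - s)) * N 2 f t"
      unfolding N_def using \<alpha> mean[OF f] s by (intro norm_2_decay[where p = 2 and \<kappa> = 0]) auto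
    from scale[OF this s] show ?thesis
      by (simp add: norm[OF s] norm_end mult_ac)
  qed
  moreover have "ereal (Lp_norm p (cond_pmf (\<mu> s) T) (q s t f))
      \<le> ereal (exp (- \<alpha> * (t - s))) * amplification \<alpha> \<beta>
          * ereal (mass t / mass s) * ereal (Lp_norm p (cond_pmf (\<mu> t) T) f)"
    if n: "n \<ge> 1" and p: "p = 2 ^ n"
      and lam: "\<forall>s\<in>{0..t}. lam s \<ge> p / 4 * A s + \<beta> * ((p - 1) / 4) * B s + \<alpha> * (p / 2) * C s"
      and s: "s \<in> {0..t}" and f: "measure_pmf.expectation (cond_pmf (\<mu> t) T) f = 0"
    for n :: nat and p s f
  proof -
    interpret fk_flow_inequalities T t cond "cond_H \<mu> T" "?w f" L lam A B C by (rule flow)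
    \<comment> \<open>The value 2 is settled by the second moment alone; from 4 on, p/2 lies between
      2 and p.\<close>
    have p24: "p = 2 \<or> p \<ge> 4"
    proof (cases "n = 1")
      case False
      then have "(2::real) ^ 2 \<le> 2 ^ n" using n by (intro power_increasing) auto
      then show ?thesis by (simp add: p)
    qed (simp add: p)
    then have p2: "p \<ge> 2" by auto
    have lam': "lam r \<ge> p / 4 * (A r + \<beta> * (p - 1) / p * B r + 2 * \<alpha> * C r)" if "r \<in> {0..t}" for r
    proof -
      have "p / 4 * (A r + \<beta> * (p - 1) / p * B r + 2 * \<alpha> * C r)
          = p / 4 * A r + \<beta> * ((p - 1) / 4) * B r + \<alpha> * (p / 2) * C r"
        using p2 by (simp add: field_simps)
      then show ?thesis using bspec[OF lam that] by simp
    qed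
    show ?thesis
    proof (cases "\<alpha> * \<beta> = 0")
      case False
      then have "\<alpha> > 0" "\<beta> > 0" using \<alpha> \<beta> by auto
      then have "N p f s \<le> exp (- \<alpha> * (t - s)) * sqrt (2 + 1 / (\<alpha> * \<beta>)) * N p f t"
        unfolding N_def by (intro norm_decay p24 lam' mean f s)
      from scale[OF this s] show ?thesis
        using p2 False by (simp add: norm[OF s] norm_end amplification_def mult_ac)
    next
      case True
      show ?thesis
      proof (cases "moment p t = 0")
        case zero: True
        have "moment p s = 0"
          using p2 \<alpha> \<beta> by (intro moment_eq_0_backward[OF p2 _ \<alpha> lam' mean[OF f] s zero]) auto
        then show ?thesis
          using p2 zero by (simp add: norm[OF s] norm_end N_def flip: zero_ereal_def)
      next
        case False
        \<comment> \<open>With all other factors positive the right-hand side is infinite.\<close>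
        then have "N p f t > 0" using moment_nonneg[of t p] t by (simp add: N_def)
        moreover have "mass t > 0" "mass s > 0" using mass_pos[OF t] mass_pos[of s] s by auto
        ultimately show ?thesis
          using p2 True by (simp add: norm_end amplification_def)
      qed
    qed
  qed
  ultimately show ?thesis
    unfolding mass_def by blast
qed

end
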